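(* Let $G\in\mathcal{G}_n^{sc}$ with Hermitian adjacency matrix $A$ and walk-matrix $W=[e,Ae,\ldots,A^{n-1}e]$ such that $\det W\neq0$. Let $U\in\mathscr{U}_G$ have level $\ell=\ell(U)$. If $2^{\lfloor n/2\rfloor+1}\nmid\det W$ (in $\mathbb{Z}[i]$), then $2\nmid\ell$.
   Context: A mixed graph is obtained from a simple undirected graph by orienting a subset of edges; $\mathcal{G}_n$ is the set of mixed graphs on $[n]$. The Hermitian adjacency matrix $A(G)=(a_{u,v})$ has $a_{u,v}=1$ for an undirected edge $uv$, $i$ for a directed edge $u\to v$, $-i$ for a directed edge $v\to u$, $0$ otherwise. $G$ is self-converse if isomorphic to the mixed graph obtained by reversing every directed edge; $\mathcal{G}_n^{sc}$ is the set of self-converse mixed graphs on $[n]$. $e$ is the all-one vector. Let $\Gamma=\{z\in\mathbb{Z}[i]:\mathrm{Re}(z)>0,\mathrm{Im}(z)\ge0\}$. For a Gaussian rational unitary matrix $U$, the level $\ell(U)$ is the unique $\ell\in\Gamma$ with $\ell U$ Gaussian integral and $N(\ell)=|\ell|^2$ minimal. $\mathscr{U}_G$ is the set of Gaussian rational unitary matrices $U$ with $Ue=e$ and $U^*A(G)U=A(H)$ for some $H\in\mathcal{G}_n^{sc}$. *)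

theory Defs
  imports
    Complex_Main
    "Jordan_Normal_Form.Determinant"
    "Jordan_Normal_Form.Schur_Decomposition"
begin

text \<open>The vertex set $[n]$ is represented by \<open>{0..<n}\<close>, matching the index convention for matrices.\<close>

record mixed_graph =
  uedges :: "nat set set"
  arcs :: "(nat \<times> nat) set"

definition mixed_graphs :: "nat \<Rightarrow> mixed_graph set" where
  "mixed_graphs n = {G.
     uedges G \<subseteq> {{u, v} | u v. u < n \<and> v < n \<and> u \<noteq> v} \<and>
     arcs G \<subseteq> {(u, v). u < n \<and> v < n \<and> u \<noteq> v} \<and>
     (\<forall>u v. (u, v) \<in> arcs G \<longrightarrow> (v, u) \<notin> arcs G \<and> {u, v} \<notin> uedges G)}"

definition converse_graph :: "mixed_graph \<Rightarrow> mixed_graph" where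
  "converse_graph G = G\<lparr>arcs := (arcs G)\<inverse>\<rparr>"

definition isomorphic_mixed :: "nat \<Rightarrow> mixed_graph \<Rightarrow> mixed_graph \<Rightarrow> bool" where
  "isomorphic_mixed n G H \<longleftrightarrow> (\<exists>f. bij_betw f {0..<n} {0..<n} \<and>
     (\<forall>u<n. \<forall>v<n. {u, v} \<in> uedges G \<longleftrightarrow> {f u, f v} \<in> uedges H) \<and>
     (\<forall>u<n. \<forall>v<n. (u, v) \<in> arcs G \<longleftrightarrow> (f u, f v) \<in> arcs H))"

definition self_converse_graphs :: "nat \<Rightarrow> mixed_graph set" where
  "self_converse_graphs n = {G \<in> mixed_graphs n. isomorphic_mixed n G (converse_graph G)}"

definition hermitian_adjacency :: "nat \<Rightarrow> mixed_graph \<Rightarrow> complex mat" where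
  "hermitian_adjacency n G = mat n n (\<lambda>(u, v).
     if {u, v} \<in> uedges G then 1
     else if (u, v) \<in> arcs G then \<i>
     else if (v, u) \<in> arcs G then - \<i>
     else 0)"

definition all_one :: "nat \<Rightarrow> complex vec" where
  "all_one n = vec n (\<lambda>_. 1)"

definition walk_matrix :: "nat \<Rightarrow> complex mat \<Rightarrow> complex mat" where
  "walk_matrix n A = mat_of_cols n (map (\<lambda>k. (A ^\<^sub>m k) *\<^sub>v all_one n) [0..<n])"

definition gauss_ints :: "complex set" where
  "gauss_ints = {z. Re z \<in> \<int> \<and> Im z \<in> \<int>}"

definition gauss_rats :: "complex set" where
  "gauss_rats = {z. Re z \<in> \<rat> \<and> Im z \<in> \<rat>}"

text \<open>Divisibility in $\mathbb{Z}[i]$; the class operation \<open>dvd\<close> on type \<open>complex\<close> is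
  divisibility in a field.\<close>

definition gauss_dvd :: "complex \<Rightarrow> complex \<Rightarrow> bool" (infix "gdvd" 50) where
  "a gdvd b \<longleftrightarrow> (\<exists>c\<in>gauss_ints. b = a * c)"

definition Gamma_set :: "complex set" where
  "Gamma_set = {z \<in> gauss_ints. Re z > 0 \<and> Im z \<ge> 0}"

definition is_level :: "complex mat \<Rightarrow> complex \<Rightarrow> bool" where
  "is_level U l \<longleftrightarrow> l \<in> Gamma_set \<and> elements_mat (l \<cdot>\<^sub>m U) \<subseteq> gauss_ints \<and>
     (\<forall>m\<in>Gamma_set. elements_mat (m \<cdot>\<^sub>m U) \<subseteq> gauss_ints \<longrightarrow> (cmod l)\<^sup>2 \<le> (cmod m)\<^sup>2)"

definition level :: "complex mat \<Rightarrow> complex" where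
  "level U = (THE l. is_level U l)"

definition gauss_rat_unitary :: "nat \<Rightarrow> complex mat set" where
  "gauss_rat_unitary n = {U \<in> carrier_mat n n. elements_mat U \<subseteq> gauss_rats \<and>
     mat_adjoint U * U = 1\<^sub>m n \<and> U * mat_adjoint U = 1\<^sub>m n}"

definition U_set :: "nat \<Rightarrow> mixed_graph \<Rightarrow> complex mat set" where
  "U_set n G = {U \<in> gauss_rat_unitary n. U *\<^sub>v all_one n = all_one n \<and>
     (\<exists>H\<in>self_converse_graphs n.
        mat_adjoint U * hermitian_adjacency n G * U = hermitian_adjacency n H)}"

subsection \<open>Existence and uniqueness of the level\<close>

lemma gauss_ints_closed:
  assumes "a \<in> gauss_ints" "b \<in> gauss_ints"
  shows "a + b \<in> gauss_ints" "a - b \<in> gauss_ints" "a * b \<in> gauss_ints"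
  using assms by (auto simp: gauss_ints_def)

lemma gauss_ints_norm:
  assumes "z \<in> gauss_ints"
  obtains k :: nat where "(cmod z)\<^sup>2 = real k"
proof -
  from assms obtain a b :: int where "Re z = of_int a" "Im z = of_int b"
    by (auto simp: gauss_ints_def elim!: Ints_cases)
  then have "(cmod z)\<^sup>2 = of_int (a\<^sup>2 + b\<^sup>2)"
    by (simp add: cmod_power2)
  also have "\<dots> = real (nat (a\<^sup>2 + b\<^sup>2))"
    by simp
  finally show ?thesis using that by blast
qed

lemma elements_smult_iff:
  "elements_mat (m \<cdot>\<^sub>m U) \<subseteq> gauss_ints \<longleftrightarrow> (\<forall>x\<in>elements_mat U. m * x \<in> gauss_ints)"
  unfolding elements_mat_def by auto

lemma Gamma_associate:
  assumes "z \<in> gauss_ints" "z \<noteq> 0"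
  obtains u where "u \<in> {1, \<i>, -1, -\<i>}" "u * z \<in> Gamma_set"
proof -
  have "1 * z \<in> gauss_ints" "\<i> * z \<in> gauss_ints" "-1 * z \<in> gauss_ints" "-\<i> * z \<in> gauss_ints"
    using assms(1) by (auto simp: gauss_ints_def)
  moreover have "Re z \<noteq> 0 \<or> Im z \<noteq> 0"
    using assms(2) by (simp add: complex_eq_iff)
  then have "(Re z > 0 \<and> Im z \<ge> 0) \<or> (Re z \<le> 0 \<and> Im z > 0)
     \<or> (Re z < 0 \<and> Im z \<le> 0) \<or> (Re z \<ge> 0 \<and> Im z < 0)" by linarith
  ultimately show ?thesis
    using that[of 1] that[of "\<i>"] that[of "-1"] that[of "-\<i>"]
    unfolding Gamma_set_def by auto
qed

lemma gauss_division:
  assumes "b \<noteq> 0"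
  obtains q where "q \<in> gauss_ints" "cmod (a - q * b) < cmod b"
proof -
  define q where "q = Complex (of_int (round (Re (a / b)))) (of_int (round (Im (a / b))))"
  have R: "\<bar>Re (a / b - q)\<bar> \<le> 1/2" "\<bar>Im (a / b - q)\<bar> \<le> 1/2"
    using of_int_round_abs_le[of "Re (a / b)"] of_int_round_abs_le[of "Im (a / b)"]
    by (auto simp: q_def abs_minus_commute)
  have "(cmod (a / b - q))\<^sup>2 \<le> (1/2)\<^sup>2 + (1/2)\<^sup>2"
    unfolding cmod_power2 using R by (intro add_mono) (auto simp only: abs_le_square_iff[symmetric])
  then have "(cmod (a / b - q))\<^sup>2 < 1\<^sup>2" by (simp add: power2_eq_square)
  then have less1: "cmod (a / b - q) < 1"
    using power2_less_imp_less by fastforce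
  have "a - q * b = (a / b - q) * b" using assms by (simp add: field_simps)
  then have "cmod (a - q * b) = cmod (a / b - q) * cmod b"
    by (simp add: norm_mult)
  then have "cmod (a - q * b) < cmod b" using less1 assms by simp
  then show ?thesis using that[of q] by (simp add: q_def gauss_ints_def)
qed

lemma gauss_rats_denominator:
  assumes "finite X" "X \<subseteq> gauss_rats"
  shows "\<exists>d::nat. d > 0 \<and> (\<forall>x\<in>X. of_nat d * x \<in> gauss_ints)"
  using assms
proof (induction X rule: finite_induct)
  case empty
  then show ?case by (intro exI[of _ 1]) auto
next
  case (insert x X)
  then obtain d where d: "d > 0" "\<forall>x\<in>X. of_nat d * x \<in> gauss_ints" by auto
  have den: "\<exists>k::nat. k > 0 \<and> real k * r \<in> \<int>" if "r \<in> \<rat>" for r :: real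
  proof -
    from that obtain a b :: int where ab: "b > 0" "r = of_int a / of_int b"
      by (metis Rats_cases')
    then have "real (nat b) * r = of_int a" by simp
    then show ?thesis using ab by (intro exI[of _ "nat b"]) auto
  qed
  have "Re x \<in> \<rat>" "Im x \<in> \<rat>"
    using insert.prems by (auto simp: gauss_rats_def)
  from this[THEN den] obtain k1 k2 :: nat where k: "k1 > 0" "k2 > 0"
    "real k1 * Re x \<in> \<int>" "real k2 * Im x \<in> \<int>"
    by blast
  have x1: "real (d * k1 * k2) * Re x = real (d * k2) * (real k1 * Re x)"
    and x2: "real (d * k1 * k2) * Im x = real (d * k1) * (real k2 * Im x)" by simp_all
  have "real (d * k1 * k2) * Re x \<in> \<int>" "real (d * k1 * k2) * Im x \<in> \<int>"
    unfolding x1 x2 using k(3,4) by (auto intro: Ints_mult)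
  then have "of_nat (d * k1 * k2) * x \<in> gauss_ints"
    by (simp add: gauss_ints_def del: of_nat_mult)
  moreover have "of_nat (d * k1 * k2) * y \<in> gauss_ints" if "y \<in> X" for y
  proof -
    have "of_nat (k1 * k2) * (of_nat d * y) \<in> gauss_ints"
      by (rule gauss_ints_closed(3)) (use d that in \<open>auto simp: gauss_ints_def\<close>)
    then show ?thesis by (simp add: ac_simps)
  qed
  ultimately show ?case using d k by (intro exI[of _ "d * k1 * k2"]) auto
qed

lemma is_level_ex1:
  assumes "elements_mat U \<subseteq> gauss_rats"
  shows "\<exists>!l. is_level U l"
proof -
  define P where "P m \<longleftrightarrow> m \<in> Gamma_set \<and> elements_mat (m \<cdot>\<^sub>m U) \<subseteq> gauss_ints" for m
  have lev: "is_level U l \<longleftrightarrow> P l \<and> (\<forall>m. P m \<longrightarrow> (cmod l)\<^sup>2 \<le> (cmod m)\<^sup>2)" for l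
    by (auto simp: is_level_def P_def)
  have "finite (elements_mat U)" by (simp add: elements_mat_def)
  from gauss_rats_denominator[OF this assms] obtain d :: nat
    where d: "d > 0" "\<forall>x\<in>elements_mat U. of_nat d * x \<in> gauss_ints" by blast
  then have Pd: "P (of_nat d)"
    unfolding P_def elements_smult_iff by (auto simp: Gamma_set_def gauss_ints_def)
  have ex: "\<exists>l. is_level U l"
  proof -
    define f where "f m = nat \<lfloor>(cmod m)\<^sup>2\<rfloor>" for m
    have f: "(cmod m)\<^sup>2 = real (f m)" if "P m" for m
      using that gauss_ints_norm[of m] unfolding P_def Gamma_set_def f_def
      by (metis (no_types, lifting) floor_of_nat mem_Collect_eq nat_int)
    obtain l where "P l" "\<forall>m. P m \<longrightarrow> f l \<le> f m"
      using ex_has_least_nat[of P _ f, OF Pd] by blast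
    then show ?thesis unfolding lev using f by auto
  qed
  moreover have "l = m" if l: "is_level U l" and m: "is_level U m" for l m
  proof -
    have Pl: "P l" and Pm: "P m" using l m by (auto simp: lev)
    have nz: "l \<noteq> 0" "m \<noteq> 0" using Pl Pm by (auto simp: P_def Gamma_set_def)
    have eqn: "cmod l = cmod m"
      using l m Pl Pm unfolding lev by (meson norm_ge_zero order_antisym power2_le_imp_le)
    obtain q where q: "q \<in> gauss_ints" "cmod (l - q * m) < cmod m"
      using gauss_division[OF nz(2)] by blast
    have lm: "l \<in> gauss_ints" "m \<in> gauss_ints" using Pl Pm by (auto simp: P_def Gamma_set_def)
    have r0: "l - q * m = 0"
    proof (rule ccontr)
      assume "l - q * m \<noteq> 0"
      moreover have "l - q * m \<in> gauss_ints"
        using lm q by (intro gauss_ints_closed)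
      ultimately obtain u where u: "u \<in> {1, \<i>, -1, -\<i>}" "u * (l - q * m) \<in> Gamma_set"
        using Gamma_associate by blast
      have ug: "u \<in> gauss_ints" using u(1) by (auto simp: gauss_ints_def)
      have "u * (l - q * m) * x \<in> gauss_ints" if "x \<in> elements_mat U" for x
      proof -
        have "l * x \<in> gauss_ints" "m * x \<in> gauss_ints"
          using that Pl Pm by (auto simp: P_def elements_smult_iff)
        then have "u * (l * x - q * (m * x)) \<in> gauss_ints"
          by (simp add: gauss_ints_closed ug q(1))
        then show ?thesis by (simp add: algebra_simps)
      qed
      then have "P (u * (l - q * m))" using u by (simp add: P_def elements_smult_iff)
      then have "(cmod m)\<^sup>2 \<le> (cmod (u * (l - q * m)))\<^sup>2" using m by (auto simp: lev)
      then have "cmod m \<le> cmod (u * (l - q * m))"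
        by (rule power2_le_imp_le) simp
      moreover have "cmod u = 1" using u(1) by auto
      ultimately show False using q(2) by (simp add: norm_mult)
    qed
    then have lq: "l = q * m" by simp
    then have "cmod q = 1" using eqn nz by (simp add: norm_mult)
    then have n1: "(Re q)\<^sup>2 + (Im q)\<^sup>2 = 1" by (metis cmod_power2 one_power2)
    from q(1) obtain a b :: int where ab: "Re q = of_int a" "Im q = of_int b"
      by (auto simp: gauss_ints_def elim!: Ints_cases)
    from n1 ab have "of_int (a\<^sup>2 + b\<^sup>2) = (1::real)" by simp
    then have ab1: "a\<^sup>2 + b\<^sup>2 = 1" by (simp only: of_int_eq_1_iff)
    have "a\<^sup>2 \<le> 1" "b\<^sup>2 \<le> 1"
      using ab1 zero_le_power2[of a] zero_le_power2[of b] by linarith+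
    then have "\<bar>a\<bar> \<le> 1" "\<bar>b\<bar> \<le> 1"
      by (simp_all only: abs_square_le_1)
    then have "a \<in> {-1, 0, 1}" "b \<in> {-1, 0, 1}" by auto
    moreover have "Re l = of_int a * Re m - of_int b * Im m"
      "Im l = of_int a * Im m + of_int b * Re m" using lq ab by simp_all
    moreover have "Re l > 0" "Im l \<ge> 0" "Re m > 0" "Im m \<ge> 0"
      using Pl Pm by (auto simp: P_def Gamma_set_def)
    ultimately have "a = 1 \<and> b = 0" using ab1 by auto
    then have "q = 1" using ab by (simp add: complex_eq_iff)
    then show ?thesis using lq by simp
  qed
  ultimately show ?thesis by blast
qed

lemma is_level_level:
  assumes "elements_mat U \<subseteq> gauss_rats"
  shows "is_level U (level U)"
  unfolding level_def by (rule theI'[OF is_level_ex1[OF assms]])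

end

theory Submission
  imports Defs
begin

text \<open>Write \<open>e\<close> for the all-one vector, \<open>\<pi> = 1 + \<i>\<close>, \<open>s k = e\<^sup>* A\<^sup>k e\<close> and \<open>h = n div 2\<close>. The integers \<open>s k\<close> are even for
  \<open>k > 0\<close>, so the Gram matrix \<open>W\<^sup>* W = (s (j + k))\<close> is a diagonal matrix of determinant \<open>2 ^ (2 * h)\<close> times an
  integer matrix \<open>M\<close>. For self-converse \<open>G\<close> the number \<open>det W\<close> is real or purely imaginary, so an even
  \<open>det M\<close> would force \<open>2 ^ (h + 1)\<close> to divide \<open>det W\<close>; hence \<open>det M\<close> is odd.

  If 2 divides the level \<open>l\<close>, some column \<open>v\<close> of \<open>l U\<close> is nonzero modulo \<open>\<pi>\<close>, while
  \<open>e\<^sup>* A\<^sup>k v\<close> vanishes modulo 2 and \<open>v\<^sup>* A\<^sup>k v\<close> modulo 4. Inverting \<open>M\<close> modulo 2 puts \<open>v\<close> into the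
  Krylov space of \<open>e\<close> modulo \<open>\<pi>\<close>. That space is totally isotropic, so (eventown) \<open>h\<close> consecutive powers of \<open>A\<close>
  span it and \<open>v\<close> is congruent to the sum of \<open>A\<^sup>i e\<close> over a nonempty set \<open>c\<close> of \<open>i\<close> with \<open>2 * i < n\<close>.
  Expanding \<open>v\<^sup>* A\<^sup>k v\<close> modulo 4 leaves only the diagonal terms \<open>s (2 * i + k)\<close>, and these say that the
  indicator vector of \<open>{2 * i | i. i \<in> c}\<close> is in the kernel of \<open>M\<close> modulo 2, contradicting \<open>odd (det M)\<close>.\<close>

section \<open>Parity of Gaussian integers\<close>

lemma gauss_ints_of_int [simp]: "of_int m \<in> gauss_ints"
  by (simp add: gauss_ints_def)

lemma gauss_ints_0 [simp]: "0 \<in> gauss_ints" and gauss_ints_1 [simp]: "1 \<in> gauss_ints"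
  and gauss_ints_numeral [simp]: "numeral w \<in> gauss_ints" and gauss_ints_i [simp]: "\<i> \<in> gauss_ints"
  by (simp_all add: gauss_ints_def)

lemma gauss_ints_cnj [simp]: "cnj z \<in> gauss_ints \<longleftrightarrow> z \<in> gauss_ints"
  by (simp add: gauss_ints_def)

lemma gauss_ints_uminus [simp]: "- z \<in> gauss_ints \<longleftrightarrow> z \<in> gauss_ints"
  by (simp add: gauss_ints_def)

lemma gauss_ints_sum: "(\<And>x. x \<in> F \<Longrightarrow> f x \<in> gauss_ints) \<Longrightarrow> sum f F \<in> gauss_ints"
  by (induction F rule: infinite_finite_induct) (auto intro: gauss_ints_closed)

lemma gauss_ints_cases:
  assumes "z \<in> gauss_ints"
  obtains p q :: int where "z = Complex (of_int p) (of_int q)"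
  using assms by (auto simp: gauss_ints_def complex_eq_iff elim!: Ints_cases)

lemma gauss_ints_real:
  assumes "z \<in> gauss_ints" "cnj z = z"
  obtains m :: int where "z = of_int m"
  using assms by (cases rule: gauss_ints_cases) (auto simp: complex_eq_iff)

text \<open>\<open>1 + \<i>\<close> is the prime above 2, with residue field of two elements.\<close>

abbreviation gauss_even :: "complex \<Rightarrow> bool" where
  "gauss_even z \<equiv> (1 + \<i>) gdvd z"

text \<open>Modulo \<open>1 + \<i>\<close> the unit \<open>\<i>\<close> becomes -1 and 2 becomes 0.
  Sums, products and conjugates are reduced to integer parity through this criterion.\<close>

lemma gauss_even_Complex: "gauss_even (Complex (of_int p) (of_int q)) \<longleftrightarrow> even (p + q)"
proof
  assume "gauss_even (Complex (of_int p) (of_int q))"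
  then obtain c where c: "c \<in> gauss_ints" "Complex (of_int p) (of_int q) = (1 + \<i>) * c"
    by (auto simp: gauss_dvd_def)
  from c(1) obtain r s where "c = Complex (of_int r) (of_int s)"
    by (rule gauss_ints_cases)
  with c(2) have "real_of_int p = of_int (r - s)" "real_of_int q = of_int (r + s)"
    by (auto simp: complex_eq_iff)
  then have "p = r - s" "q = r + s" by linarith+
  then show "even (p + q)" by simp
next
  assume "even (p + q)"
  then obtain r where "p + q = 2 * r" by (elim evenE)
  then have "p = 2 * r - q" by simp
  then have "Complex (of_int p) (of_int q) = (1 + \<i>) * Complex (of_int r) (of_int (q - r))"
    by (simp add: complex_eq_iff)
  then show "gauss_even (Complex (of_int p) (of_int q))"
    unfolding gauss_dvd_def by (intro bexI) (auto simp: gauss_ints_def)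
qed

lemma gauss_even_of_int [simp]: "gauss_even (of_int m) \<longleftrightarrow> even m"
  using gauss_even_Complex[of m 0] by (simp add: complex_of_real_def[symmetric])

lemma gauss_even_0 [simp]: "gauss_even 0"
  using gauss_even_of_int[of 0] by simp

lemma gauss_even_add:
  assumes "x \<in> gauss_ints" "y \<in> gauss_ints"
  shows "gauss_even (x + y) \<longleftrightarrow> (gauss_even x \<longleftrightarrow> gauss_even y)"
proof -
  obtain p q r s where xy: "x = Complex (of_int p) (of_int q)" "y = Complex (of_int r) (of_int s)"
    using assms by (auto elim!: gauss_ints_cases)
  then have "x + y = Complex (of_int (p + r)) (of_int (q + s))" by (simp add: complex_eq_iff)
  then show ?thesis unfolding xy by (simp only: gauss_even_Complex) auto
qed

lemma gauss_even_uminus [simp]: "gauss_even (- x) \<longleftrightarrow> gauss_even x"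
  unfolding gauss_dvd_def by (metis gauss_ints_uminus minus_minus mult_minus_right)

lemma gauss_even_diff:
  assumes "x \<in> gauss_ints" "y \<in> gauss_ints"
  shows "gauss_even (x - y) \<longleftrightarrow> (gauss_even x \<longleftrightarrow> gauss_even y)"
  using gauss_even_add[of x "- y"] assms by simp

lemma gauss_even_mult:
  assumes "x \<in> gauss_ints" "y \<in> gauss_ints"
  shows "gauss_even (x * y) \<longleftrightarrow> gauss_even x \<or> gauss_even y"
proof -
  obtain p q r s where xy: "x = Complex (of_int p) (of_int q)" "y = Complex (of_int r) (of_int s)"
    using assms by (auto elim!: gauss_ints_cases)
  then have "x * y = Complex (of_int (p * r - q * s)) (of_int (p * s + q * r))"
    by (simp add: complex_eq_iff)
  then show ?thesis unfolding xy by (simp only: gauss_even_Complex) auto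
qed

lemma gauss_even_cnj [simp]:
  assumes "x \<in> gauss_ints"
  shows "gauss_even (cnj x) \<longleftrightarrow> gauss_even x"
proof -
  obtain p q where x: "x = Complex (of_int p) (of_int q)"
    using assms by (auto elim!: gauss_ints_cases)
  then have "cnj x = Complex (of_int p) (of_int (- q))" by (simp add: complex_eq_iff)
  then show ?thesis unfolding x by (simp only: gauss_even_Complex) auto
qed

lemma gauss_even_sum_iff:
  assumes "finite F" "\<And>x. x \<in> F \<Longrightarrow> f x \<in> gauss_ints"
  shows "gauss_even (sum f F) \<longleftrightarrow> even (card {x \<in> F. \<not> gauss_even (f x)})"
  using assms
proof (induction F rule: finite_induct)
  case (insert x F)
  have "{y \<in> insert x F. \<not> gauss_even (f y)} =
    (if gauss_even (f x) then {y \<in> F. \<not> gauss_even (f y)} else insert x {y \<in> F. \<not> gauss_even (f y)})"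
    by auto
  then show ?case
    using insert by (simp add: gauss_even_add gauss_ints_sum)
qed simp

lemma gauss_even_sum:
  assumes "finite F" "\<And>x. x \<in> F \<Longrightarrow> f x \<in> gauss_ints" "\<And>x. x \<in> F \<Longrightarrow> gauss_even (f x)"
  shows "gauss_even (sum f F)"
proof -
  have "{x \<in> F. \<not> gauss_even (f x)} = {}" using assms(3) by auto
  then show ?thesis using gauss_even_sum_iff[of F f] assms by (simp only: card.empty) auto
qed

lemma two_gdvd_imp_gauss_even: "2 gdvd z \<Longrightarrow> gauss_even z"
  unfolding gauss_dvd_def
  by (auto intro!: bexI[of _ "(1 - \<i>) * _"] gauss_ints_closed simp: complex_eq_iff)

text \<open>As 2 is a unit times the square of \<open>1 + \<i>\<close>, cancelling one factor leaves
  the other.\<close>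

lemma two_gdvd_one_plus_i_mult:
  assumes "2 gdvd (1 + \<i>) * z"
  shows "gauss_even z"
proof -
  from assms obtain c where c: "c \<in> gauss_ints" "(1 + \<i>) * z = 2 * c" by (auto simp: gauss_dvd_def)
  have "(1 - \<i>) * ((1 + \<i>) * z) = 2 * z" by (simp add: complex_eq_iff)
  then have "2 * z = (1 - \<i>) * (2 * c)" using c by simp
  also have "\<dots> = 2 * ((1 + \<i>) * (- \<i> * c))" by (simp add: complex_eq_iff)
  finally have "z = (1 + \<i>) * (- \<i> * c)" by simp
  moreover have "- \<i> * c \<in> gauss_ints" using c by (intro gauss_ints_closed) auto
  ultimately show ?thesis unfolding gauss_dvd_def by blast
qed

text \<open>The real part of the Gaussian quotient is an integer quotient.\<close>

lemma gdvd_of_int: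
  assumes "of_int m gdvd of_int k"
  shows "m dvd k"
proof -
  from assms obtain c where c: "c \<in> gauss_ints" "of_int k = of_int m * c" by (auto simp: gauss_dvd_def)
  from c(1) obtain p q where "c = Complex (of_int p) (of_int q)" by (rule gauss_ints_cases)
  with c(2) have "real_of_int k = of_int (m * p)" by (simp add: complex_eq_iff)
  then have "k = m * p" by linarith
  then show ?thesis by simp
qed

section \<open>Families of sets with even intersections\<close>

text \<open>Toggling a fixed element of \<open>D\<close> pairs the subsets of \<open>V\<close> and
  flips the sign.\<close>

lemma sum_neg_one_card_inter:
  fixes D V :: "'a set"
  assumes "finite V" "D \<subseteq> V" "D \<noteq> {}"
  shows "(\<Sum>Z\<in>Pow V. (-1::int) ^ card (D \<inter> Z)) = 0"
proof -
  obtain d where d: "d \<in> D" using assms by auto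
  define V' where "V' = V - {d}"
  have V: "V = insert d V'" "d \<notin> V'" "finite V'" using d assms by (auto simp: V'_def)
  have inj: "inj_on (insert d) (Pow V')" using V by (auto simp: inj_on_def)
  have "(\<Sum>Z\<in>Pow V. (-1::int) ^ card (D \<inter> Z)) =
      (\<Sum>Z\<in>Pow V'. (-1) ^ card (D \<inter> Z)) + (\<Sum>Z\<in>insert d ` Pow V'. (-1) ^ card (D \<inter> Z))"
    unfolding V(1) Pow_insert using V by (intro sum.union_disjoint) auto
  also have "(\<Sum>Z\<in>insert d ` Pow V'. (-1::int) ^ card (D \<inter> Z)) = (\<Sum>Z\<in>Pow V'. - ((-1) ^ card (D \<inter> Z)))"
    unfolding sum.reindex[OF inj] o_def
  proof (rule sum.cong[OF refl])
    fix Z assume "Z \<in> Pow V'"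
    then have "D \<inter> insert d Z = insert d (D \<inter> Z)" "d \<notin> D \<inter> Z" "finite (D \<inter> Z)"
      using d V finite_subset[of Z V'] by auto
    then show "(-1::int) ^ card (D \<inter> insert d Z) = - ((-1) ^ card (D \<inter> Z))" by simp
  qed
  finally show ?thesis by (simp add: sum_negf)
qed

text \<open>Elements common to \<open>X\<close> and \<open>Y\<close> enter both exponents and drop
  out.\<close>

lemma neg_one_card_sym_diff:
  assumes "finite X" "finite Y"
  shows "(-1::int) ^ card (X \<inter> Z) * (-1) ^ card (Y \<inter> Z) = (-1) ^ card (((X - Y) \<union> (Y - X)) \<inter> Z)"
proof -
  have 1: "card (X \<inter> Z) = card ((X - Y) \<inter> Z) + card (X \<inter> Y \<inter> Z)"
    by (subst card_Un_disjoint[symmetric]) (use assms in \<open>auto intro!: arg_cong[of _ _ card]\<close>)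
  have 2: "card (Y \<inter> Z) = card ((Y - X) \<inter> Z) + card (X \<inter> Y \<inter> Z)"
    by (subst card_Un_disjoint[symmetric]) (use assms in \<open>auto intro!: arg_cong[of _ _ card]\<close>)
  have 3: "card (((X - Y) \<union> (Y - X)) \<inter> Z) = card ((X - Y) \<inter> Z) + card ((Y - X) \<inter> Z)"
    by (subst card_Un_disjoint[symmetric]) (use assms in \<open>auto intro!: arg_cong[of _ _ card]\<close>)
  have "((-1::int) ^ k) * (-1) ^ k = 1" for k by (simp flip: power_mult_distrib)
  then show ?thesis unfolding 1 2 3 power_add by (simp add: algebra_simps)
qed

text \<open>The eventown bound, by orthogonality of the characters \<open>Z \<mapsto> (-1) ^ card (X \<inter> Z)\<close>: each of the
  members \<open>Z\<close> of \<open>F\<close> contributes \<open>(card F)\<^sup>2\<close> to the total squared character sum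
  \<open>2 ^ card V * card F\<close>.\<close>

lemma eventown_bound:
  fixes V :: "'a set"
  assumes V: "finite V" and F: "F \<subseteq> Pow V"
    and even: "\<And>X Y. X \<in> F \<Longrightarrow> Y \<in> F \<Longrightarrow> even (card (X \<inter> Y))"
  shows "(card F)\<^sup>2 \<le> 2 ^ card V"
proof (cases "F = {}")
  case False
  have finF: "finite F" using V F by (meson finite_Pow_iff finite_subset)
  have fin: "finite X" if "X \<in> F" for X using that F V finite_subset by blast
  define S where "S Z = (\<Sum>X\<in>F. (-1::int) ^ card (X \<inter> Z))" for Z
  have "(\<Sum>Z\<in>Pow V. (S Z)\<^sup>2) =
      (\<Sum>Z\<in>Pow V. \<Sum>X\<in>F. \<Sum>Y\<in>F. (-1) ^ card (((X - Y) \<union> (Y - X)) \<inter> Z))"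
    unfolding S_def power2_eq_square sum_product
    by (intro sum.cong refl neg_one_card_sym_diff fin)
  also have "\<dots> = (\<Sum>X\<in>F. \<Sum>Z\<in>Pow V. \<Sum>Y\<in>F. (-1) ^ card (((X - Y) \<union> (Y - X)) \<inter> Z))"
    by (rule sum.swap)
  also have "\<dots> = (\<Sum>X\<in>F. \<Sum>Y\<in>F. \<Sum>Z\<in>Pow V. (-1) ^ card (((X - Y) \<union> (Y - X)) \<inter> Z))"
    by (intro sum.cong refl sum.swap)
  also have "\<dots> = (\<Sum>X\<in>F. \<Sum>Y\<in>F. if X = Y then 2 ^ card V else 0)"
  proof (intro sum.cong refl)
    fix X Y assume XY: "X \<in> F" "Y \<in> F"
    show "(\<Sum>Z\<in>Pow V. (-1::int) ^ card (((X - Y) \<union> (Y - X)) \<inter> Z)) = (if X = Y then 2 ^ card V else 0)"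
    proof (cases "X = Y")
      case True
      then show ?thesis using V by (simp add: card_Pow)
    next
      case False
      then show ?thesis using sum_neg_one_card_inter[OF V, of "(X - Y) \<union> (Y - X)"] XY F by auto
    qed
  qed
  also have "\<dots> = 2 ^ card V * int (card F)" using finF by simp
  finally have total: "(\<Sum>Z\<in>Pow V. (S Z)\<^sup>2) = 2 ^ card V * int (card F)" .
  have "S Z = int (card F)" if "Z \<in> F" for Z
    unfolding S_def using even that by simp
  then have "int (card F) * (int (card F))\<^sup>2 = (\<Sum>Z\<in>F. (S Z)\<^sup>2)" by simp
  also have "\<dots> \<le> (\<Sum>Z\<in>Pow V. (S Z)\<^sup>2)"
    by (rule sum_mono2) (use V F in auto)
  finally have "int (card F) * (int (card F))\<^sup>2 \<le> int (card F) * 2 ^ card V"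
    using total by (simp add: mult.commute)
  moreover have "card F > 0" using False finF by (simp add: card_gt_0_iff)
  ultimately have "(int (card F))\<^sup>2 \<le> 2 ^ card V" by simp
  then have "int ((card F)\<^sup>2) \<le> int (2 ^ card V)" by simp
  then show ?thesis by (simp only: of_nat_le_iff)
qed simp

section \<open>Hermitian Gaussian matrices with zero diagonal\<close>

text \<open>The row and the column added in the induction step are conjugate, so together they
  contribute twice a real part.\<close>

lemma sum_hermitian_zero_diag_even:
  fixes f :: "nat \<Rightarrow> nat \<Rightarrow> complex"
  assumes "\<And>u v. f u v \<in> gauss_ints" "\<And>u v. cnj (f u v) = f v u" "\<And>u. f u u = 0"
  shows "\<exists>m::int. (\<Sum>u<n. \<Sum>v<n. f u v) = of_int (2 * m)"
proof (induction n)
  case (Suc n)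
  then obtain m :: int where m: "(\<Sum>u<n. \<Sum>v<n. f u v) = of_int (2 * m)" by blast
  define r where "r = (\<Sum>u<n. f u n)"
  have "r \<in> gauss_ints" unfolding r_def using assms by (intro gauss_ints_sum) auto
  then obtain p q where pq: "r = Complex (of_int p) (of_int q)" by (rule gauss_ints_cases)
  have "(\<Sum>u<Suc n. \<Sum>v<Suc n. f u v) = (\<Sum>u<n. \<Sum>v<n. f u v) + r + (\<Sum>v<n. f n v)"
    using assms(3) by (simp add: sum.distrib r_def)
  also have "(\<Sum>v<n. f n v) = cnj r" unfolding r_def by (simp add: assms(2))
  also have "(\<Sum>u<n. \<Sum>v<n. f u v) + r + cnj r = of_int (2 * (m + p))"
    unfolding m pq by (simp add: complex_eq_iff)
  finally show ?case by blast
qed (auto intro: exI[of _ 0])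

text \<open>Vectors and matrices are functions on all naturals and only the sums are cut at
  \<open>n\<close>, which spares dimension conditions.\<close>

locale gauss_hermitian =
  fixes n :: nat and a :: "nat \<Rightarrow> nat \<Rightarrow> complex"
  assumes a_gauss: "a u v \<in> gauss_ints"
    and a_cnj: "cnj (a u v) = a v u"
    and a_diag: "a u u = 0"
begin

definition T :: "(nat \<Rightarrow> complex) \<Rightarrow> nat \<Rightarrow> complex" where
  "T x u = (\<Sum>v<n. a u v * x v)"

definition ip :: "(nat \<Rightarrow> complex) \<Rightarrow> (nat \<Rightarrow> complex) \<Rightarrow> complex" where
  "ip x y = (\<Sum>u<n. cnj (x u) * y u)"

abbreviation one :: "nat \<Rightarrow> complex" where
  "one \<equiv> \<lambda>_. 1"

abbreviation gvec :: "(nat \<Rightarrow> complex) \<Rightarrow> bool" where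
  "gvec x \<equiv> \<forall>u. x u \<in> gauss_ints"

lemma gvec_T: "gvec x \<Longrightarrow> gvec (T x)"
  unfolding T_def by (auto intro!: gauss_ints_sum gauss_ints_closed a_gauss)

lemma gvec_pow: "gvec x \<Longrightarrow> gvec ((T ^^ k) x)"
  by (induction k) (simp_all add: gvec_T)

lemma ip_gauss: "gvec x \<Longrightarrow> gvec y \<Longrightarrow> ip x y \<in> gauss_ints"
  unfolding ip_def by (auto intro!: gauss_ints_sum gauss_ints_closed)

lemma T_sum: "T (\<lambda>u. \<Sum>i\<in>c. g i * f i u) = (\<lambda>u. \<Sum>i\<in>c. g i * T (f i) u)"
  unfolding T_def sum_distrib_left by (subst sum.swap) (simp add: ac_simps)

lemma pow_sum: "(T ^^ k) (\<lambda>u. \<Sum>i\<in>c. g i * f i u) = (\<lambda>u. \<Sum>i\<in>c. g i * (T ^^ k) (f i) u)"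
  by (induction k) (simp_all add: T_sum)

lemma T_add_smult: "T (\<lambda>u. x u + r * y u) = (\<lambda>u. T x u + r * T y u)"
  unfolding T_def by (simp add: sum.distrib sum_distrib_left algebra_simps)

lemma pow_add_smult: "(T ^^ k) (\<lambda>u. x u + r * y u) = (\<lambda>u. (T ^^ k) x u + r * (T ^^ k) y u)"
  by (induction k) (simp_all add: T_add_smult)

lemma T_cong: "(\<And>u. u < n \<Longrightarrow> x u = y u) \<Longrightarrow> T x = T y"
  unfolding T_def by (auto intro!: sum.cong)

lemma pow_cong: "(\<And>u. u < n \<Longrightarrow> x u = y u) \<Longrightarrow> u < n \<Longrightarrow> (T ^^ k) x u = (T ^^ k) y u"
proof (induction k arbitrary: u)
  case (Suc k)
  then show ?case using T_cong[of "(T ^^ k) x" "(T ^^ k) y"] by simp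
qed simp

lemma ip_cong: "(\<And>u. u < n \<Longrightarrow> x u = x' u) \<Longrightarrow> (\<And>u. u < n \<Longrightarrow> y u = y' u) \<Longrightarrow> ip x y = ip x' y'"
  unfolding ip_def by (auto intro!: sum.cong)

lemma ip_sum_right: "ip x (\<lambda>u. \<Sum>i\<in>c. g i * f i u) = (\<Sum>i\<in>c. g i * ip x (f i))"
  unfolding ip_def sum_distrib_left by (subst sum.swap) (simp add: ac_simps)

lemma cnj_ip: "cnj (ip x y) = ip y x"
  unfolding ip_def by (simp add: ac_simps)

lemma ip_sum_left: "ip (\<lambda>u. \<Sum>i\<in>c. f i u) y = (\<Sum>i\<in>c. ip (f i) y)"
  unfolding ip_def by (subst sum.swap) (simp add: sum_distrib_right)

lemma ip_add_smult_right: "ip x (\<lambda>u. y u + r * z u) = ip x y + r * ip x z"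
  unfolding ip_def by (simp add: sum.distrib sum_distrib_left algebra_simps)

lemma ip_add_smult_left: "ip (\<lambda>u. y u + r * z u) x = ip y x + cnj r * ip z x"
  unfolding ip_def by (simp add: sum.distrib sum_distrib_left algebra_simps)

lemma ip_T: "ip (T x) y = ip x (T y)"
proof -
  have "ip (T x) y = (\<Sum>u<n. \<Sum>v<n. a v u * cnj (x v) * y u)"
    unfolding ip_def T_def by (simp add: sum_distrib_right a_cnj)
  also have "\<dots> = (\<Sum>v<n. \<Sum>u<n. a v u * cnj (x v) * y u)" by (rule sum.swap)
  also have "\<dots> = ip x (T y)"
    unfolding ip_def T_def sum_distrib_left by (simp add: ac_simps)
  finally show ?thesis .
qed

lemma ip_pow: "ip ((T ^^ k) x) y = ip x ((T ^^ k) y)"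
proof (induction k arbitrary: y)
  case (Suc k)
  have "ip ((T ^^ Suc k) x) y = ip x ((T ^^ k) (T y))" by (simp add: ip_T Suc)
  then show ?case by (simp add: funpow_swap1)
qed simp

lemma ip_pow_pow: "ip ((T ^^ j) x) ((T ^^ k) y) = ip x ((T ^^ (j + k)) y)"
  by (simp add: ip_pow funpow_add)

lemma ip_pow_int:
  assumes "gvec x"
  obtains m :: int where "ip x ((T ^^ k) x) = of_int m"
proof (rule gauss_ints_real)
  show "ip x ((T ^^ k) x) \<in> gauss_ints" by (intro ip_gauss gvec_pow assms)
  show "cnj (ip x ((T ^^ k) x)) = ip x ((T ^^ k) x)" by (simp add: cnj_ip ip_pow)
qed

lemma ip_T_even:
  assumes "gvec x"
  shows "\<exists>m::int. ip x (T x) = of_int (2 * m)"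
proof -
  have "ip x (T x) = (\<Sum>u<n. \<Sum>v<n. cnj (x u) * a u v * x v)"
    unfolding ip_def T_def sum_distrib_left by (simp add: ac_simps)
  moreover have "\<exists>m::int. (\<Sum>u<n. \<Sum>v<n. cnj (x u) * a u v * x v) = of_int (2 * m)"
    by (rule sum_hermitian_zero_diag_even)
      (use assms in \<open>auto simp: a_cnj a_diag a_gauss ac_simps intro!: gauss_ints_closed\<close>)
  ultimately show ?thesis by simp
qed

text \<open>In the residue field of two elements \<open>cnj z * z\<close> equals \<open>z\<close>,
  so both inner products count the odd coordinates of \<open>x\<close>.\<close>

lemma gauss_even_ip_self:
  assumes "gvec x"
  shows "gauss_even (ip x x) \<longleftrightarrow> gauss_even (ip one x)"
proof -
  have "{u \<in> {..<n}. \<not> gauss_even (cnj (x u) * x u)} = {u \<in> {..<n}. \<not> gauss_even (cnj 1 * x u)}"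
    using assms by (auto simp: gauss_even_mult)
  then show ?thesis
    unfolding ip_def
    by (subst (1 2) gauss_even_sum_iff) (use assms in \<open>auto intro!: gauss_ints_closed\<close>)
qed

text \<open>For even \<open>k\<close> the form is the squared norm of the half power of
  \<open>T\<close> at \<open>x\<close>, which reduces to \<open>ip one\<close>. For odd
  \<open>k\<close> it is \<open>ip y (T y)\<close> for such a power \<open>y\<close>, even because
  the diagonal vanishes.\<close>

lemma gauss_even_ip_pow:
  assumes x: "gvec x" and ev: "\<And>j. k = 2 * j \<Longrightarrow> gauss_even (ip one ((T ^^ j) x))"
  shows "gauss_even (ip x ((T ^^ k) x))"
proof (cases "even k")
  case True
  then obtain j where j: "k = 2 * j" by (elim evenE)
  have "ip x ((T ^^ k) x) = ip ((T ^^ j) x) ((T ^^ j) x)"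
    unfolding ip_pow_pow by (simp add: j mult_2)
  then show ?thesis using gauss_even_ip_self[OF gvec_pow[OF x]] ev j by simp
next
  case False
  then obtain j where j: "k = 2 * j + 1" by (elim oddE)
  have "ip x ((T ^^ k) x) = ip ((T ^^ j) x) (T ((T ^^ j) x))"
    using ip_pow_pow[of j x "Suc j" x] by (simp add: j mult_2)
  then show ?thesis using ip_T_even[OF gvec_pow[OF x, of j]] by (metis gauss_even_of_int even_mult_iff even_numeral)
qed

section \<open>The numbers \<open>s k\<close> attached to the all-one vector, and their
  parity\<close>

definition s :: "nat \<Rightarrow> int" where
  "s k = \<lfloor>Re (ip one ((T ^^ k) one))\<rfloor>"

lemma of_int_s: "of_int (s k) = ip one ((T ^^ k) one)"
proof -
  obtain m :: int where "ip one ((T ^^ k) one) = of_int m"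
    by (rule ip_pow_int[of one k]) simp
  then show ?thesis unfolding s_def by simp
qed

lemma s_0: "s 0 = int n"
  by (simp add: s_def ip_def)

text \<open>At odd arguments evenness is unconditional; \<open>s (2 * j)\<close> inherits it from
  \<open>s j\<close>.\<close>

lemma even_s: "k > 0 \<Longrightarrow> even (s k)"
proof (induction k rule: less_induct)
  case (less k)
  have "gauss_even (ip one ((T ^^ k) one))"
    by (rule gauss_even_ip_pow) (use less in \<open>auto simp flip: of_int_s\<close>)
  then show ?case by (simp flip: of_int_s)
qed

text \<open>The threshold excludes the argument 0 exactly when \<open>s 0 = n\<close> is
  odd.\<close>

lemma even_s': "i \<ge> n mod 2 \<Longrightarrow> even (s i)"
  using even_s[of i] by (cases "i = 0") (auto simp: s_0)

lemma gauss_even_T: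
  assumes "gvec x" "\<And>u. u < n \<Longrightarrow> gauss_even (x u)"
  shows "gauss_even (T x u)"
  unfolding T_def
  by (rule gauss_even_sum) (use assms a_gauss in \<open>auto simp: gauss_even_mult intro!: gauss_ints_closed\<close>)

lemma gauss_even_pow:
  assumes "gvec x" "\<And>u. u < n \<Longrightarrow> gauss_even (x u)" "u < n"
  shows "gauss_even ((T ^^ k) x u)"
  using assms(3)
proof (induction k arbitrary: u)
  case (Suc k)
  then show ?case using gauss_even_T[OF gvec_pow[OF assms(1), of k]] by simp
qed (use assms in auto)

section \<open>Krylov vectors of the all-one vector modulo \<open>1 + \<i>\<close>\<close>

definition kry :: "nat set \<Rightarrow> nat \<Rightarrow> complex" where
  "kry c u = (\<Sum>i\<in>c. (T ^^ i) one u)"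

lemma gvec_kry: "gvec (kry c)"
  unfolding kry_def using gvec_pow[of one] by (auto intro!: gauss_ints_sum)

lemma kry_alt: "kry c = (\<lambda>u. \<Sum>i\<in>c. 1 * (T ^^ i) one u)"
  by (auto simp: kry_def)

lemma ip_kry_kry: "ip (kry c) ((T ^^ k) (kry d)) = of_int (\<Sum>i\<in>c. \<Sum>j\<in>d. s (i + k + j))"
proof -
  have "ip (kry c) ((T ^^ k) (kry d)) = (\<Sum>i\<in>c. \<Sum>j\<in>d. ip ((T ^^ i) one) ((T ^^ k) ((T ^^ j) one)))"
    unfolding kry_alt[of d] pow_sum ip_sum_right unfolding kry_def ip_sum_left
    by (subst sum.swap) simp
  also have "\<dots> = (\<Sum>i\<in>c. \<Sum>j\<in>d. of_int (s (i + k + j)))"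
    by (intro sum.cong refl) (simp add: of_int_s ip_pow funpow_add)
  finally show ?thesis by simp
qed

text \<open>Subsets of the window act as coefficient vectors over the field of two elements. The
  sets \<open>P c\<close> of odd coordinates meet evenly, so by the eventown bound there are fewer
  of them than the \<open>2 ^ (h + 1)\<close> subsets. Two subsets giving the same set yield a
  dependency, their symmetric difference.\<close>

lemma kry_dependent:
  defines "b \<equiv> n mod 2" and "h \<equiv> n div 2"
  obtains d where "d \<noteq> {}" "d \<subseteq> {b..b + h}" "\<And>u. u < n \<Longrightarrow> gauss_even (kry d u)"
proof -
  define P where "P c = {u. u < n \<and> \<not> gauss_even (kry c u)}" for c
  let ?C = "Pow {b..b + h}"
  have "even (card (X \<inter> Y))" if XY: "X \<in> P ` ?C" "Y \<in> P ` ?C" for X Y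
  proof -
    obtain c d where cd: "c \<subseteq> {b..b + h}" "d \<subseteq> {b..b + h}" "X = P c" "Y = P d" using XY by auto
    \<comment> \<open>The parity of this inner product is that of the intersection of the two
      supports.\<close>
    have "gauss_even (ip (kry c) ((T ^^ 0) (kry d)))"
      unfolding ip_kry_kry gauss_even_of_int
      using cd by (intro dvd_sum even_s') (auto simp: b_def)
    then have "even (card {u \<in> {..<n}. \<not> gauss_even (cnj (kry c u) * kry d u)})"
      unfolding ip_def using gvec_kry by (subst (asm) gauss_even_sum_iff) (auto intro!: gauss_ints_closed)
    also have "{u \<in> {..<n}. \<not> gauss_even (cnj (kry c u) * kry d u)} = X \<inter> Y"
      unfolding cd P_def using gvec_kry by (auto simp: gauss_even_mult)
    finally show ?thesis .
  qed
  then have le: "(card (P ` ?C))\<^sup>2 \<le> 2 ^ n"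
    using eventown_bound[of "{..<n}" "P ` ?C"] by (auto simp: P_def)
  have "\<not> inj_on P ?C"
  proof
    assume "inj_on P ?C"
    then have "card (P ` ?C) = 2 ^ (h + 1)" by (simp add: card_image card_Pow)
    then have "(2::nat) ^ (2 * (h + 1)) \<le> 2 ^ n" using le by (simp add: power_mult power2_eq_square power_add mult.commute flip: power_mult_distrib)
    then have "2 * (h + 1) \<le> n" by (subst (asm) power_increasing_iff) auto
    then show False unfolding h_def by presburger
  qed
  then obtain c d where cd: "c \<subseteq> {b..b + h}" "d \<subseteq> {b..b + h}" "P c = P d" "c \<noteq> d"
    by (auto simp: inj_on_def)
  define e where "e = (c - d) \<union> (d - c)"
  have fin: "finite c" "finite d" using cd finite_subset by blast+
  have "gauss_even (kry e u)" if "u < n" for u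
  proof -
    have "kry c u = kry (c - d) u + kry (c \<inter> d) u" "kry d u = kry (d - c) u + kry (c \<inter> d) u"
      "kry e u = kry (c - d) u + kry (d - c) u"
      unfolding kry_def e_def
      by (subst sum.union_disjoint[symmetric], use fin in \<open>auto intro!: arg_cong2[of _ _ _ _ sum]\<close>)+
    moreover have "gauss_even (kry c u) \<longleftrightarrow> gauss_even (kry d u)" using cd(3) that by (auto simp: P_def)
    ultimately show ?thesis using gvec_kry by (auto simp: gauss_even_add)
  qed
  moreover have "e \<noteq> {}" "e \<subseteq> {b..b + h}" using cd by (auto simp: e_def)
  ultimately show thesis using that by blast
qed

text \<open>The span, modulo \<open>1 + \<i>\<close>, of the Krylov vectors with exponents in a window of length \<open>n div 2\<close>.
  For odd \<open>n\<close> the window omits the exponent 0, since \<open>s 0 = n\<close> is odd.\<close>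

definition short_kry :: "(nat \<Rightarrow> complex) \<Rightarrow> bool" where
  "short_kry x \<longleftrightarrow> gvec x \<and>
     (\<exists>c\<subseteq>{n mod 2..<n mod 2 + n div 2}. \<forall>u<n. gauss_even (x u - kry c u))"

text \<open>Common exponents count twice and vanish modulo \<open>1 + \<i>\<close>, so the symmetric
  difference represents the sum.\<close>

lemma short_kry_add:
  assumes "short_kry x" "short_kry y"
  shows "short_kry (\<lambda>u. x u + y u)"
proof -
  obtain c d where cd: "c \<subseteq> {n mod 2..<n mod 2 + n div 2}" "d \<subseteq> {n mod 2..<n mod 2 + n div 2}"
    "\<forall>u<n. gauss_even (x u - kry c u)" "\<forall>u<n. gauss_even (y u - kry d u)"
    using assms unfolding short_kry_def by blast
  have xy: "gvec x" "gvec y" using assms by (auto simp: short_kry_def)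
  define e where "e = (c - d) \<union> (d - c)"
  have fin: "finite c" "finite d" using cd finite_subset by blast+
  have "gauss_even (x u + y u - kry e u)" if "u < n" for u
  proof -
    have "kry c u = kry (c - d) u + kry (c \<inter> d) u" "kry d u = kry (d - c) u + kry (c \<inter> d) u"
      "kry e u = kry (c - d) u + kry (d - c) u"
      unfolding kry_def e_def
      by (subst sum.union_disjoint[symmetric], use fin in \<open>auto intro!: arg_cong2[of _ _ _ _ sum]\<close>)+
    moreover have "gauss_even (x u - kry c u)" "gauss_even (y u - kry d u)" using cd that by auto
    ultimately show ?thesis
      using gvec_kry xy by (auto simp: gauss_even_add gauss_even_diff gauss_ints_closed)
  qed
  moreover have "e \<subseteq> {n mod 2..<n mod 2 + n div 2}" using cd by (auto simp: e_def)
  ultimately show ?thesis using xy unfolding short_kry_def by (auto intro!: gauss_ints_closed)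
qed

lemma short_kry_0: "short_kry (\<lambda>u. 0)"
  unfolding short_kry_def by (auto simp: kry_def intro!: exI[of _ "{}"])

lemma short_kry_cong:
  assumes "short_kry x" "gvec y" "\<And>u. u < n \<Longrightarrow> gauss_even (y u - x u)"
  shows "short_kry y"
proof -
  have "gauss_even (y u - kry c u)" if "gauss_even (x u - kry c u)" "u < n" for u c
  proof -
    have "y u - kry c u = (y u - x u) + (x u - kry c u)" by simp
    then show ?thesis
      using assms that gvec_kry unfolding short_kry_def by (simp only: gauss_even_add gauss_ints_closed)
  qed
  then show ?thesis using assms unfolding short_kry_def by blast
qed

lemma short_kry_smult:
  assumes "short_kry x" "r \<in> gauss_ints"
  shows "short_kry (\<lambda>u. r * x u)"
proof -
  have x: "gvec x" using assms by (auto simp: short_kry_def)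
  show ?thesis
  proof (cases "gauss_even r")
    case True
    then show ?thesis
      by (intro short_kry_cong[OF short_kry_0])
        (use x assms in \<open>auto intro: gauss_ints_closed simp: gauss_even_mult\<close>)
  next
    case False
    then show ?thesis
      by (intro short_kry_cong[OF assms(1)])
        (use x assms in \<open>auto intro: gauss_ints_closed simp: gauss_even_mult gauss_even_diff gauss_ints_closed\<close>)
  qed
qed

lemma short_kry_sum:
  assumes "finite F" "\<And>i. i \<in> F \<Longrightarrow> short_kry (f i)" "\<And>i. i \<in> F \<Longrightarrow> g i \<in> gauss_ints"
  shows "short_kry (\<lambda>u. \<Sum>i\<in>F. g i * f i u)"
  using assms by (induction F rule: finite_induct) (auto simp: short_kry_0 intro!: short_kry_add short_kry_smult)

lemma short_kry_kry:
  assumes "c \<subseteq> {n mod 2..<n mod 2 + n div 2}"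
  shows "short_kry (kry c)"
  using assms gvec_kry unfolding short_kry_def by (auto intro!: exI[of _ c])

text \<open>A dependency among \<open>n div 2 + 1\<close> consecutive powers, shifted by a further
  power of \<open>T\<close>, rewrites every later power through smaller admissible
  exponents.\<close>

lemma short_kry_pow_one: "k \<ge> n mod 2 \<Longrightarrow> short_kry ((T ^^ k) one)"
proof (induction k rule: less_induct)
  case (less k)
  show ?case
  proof (cases "k < n mod 2 + n div 2")
    case True
    have "kry {k} = (T ^^ k) one" by (auto simp: kry_def)
    then show ?thesis using short_kry_kry[of "{k}"] True less.prems by auto
  next
    case False
    obtain d where d: "d \<noteq> {}" "d \<subseteq> {n mod 2..n mod 2 + n div 2}" "\<And>u. u < n \<Longrightarrow> gauss_even (kry d u)"
      using kry_dependent by blast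
    have fin: "finite d" using d finite_subset by blast
    define m where "m = Max d"
    have m: "m \<in> d" "\<And>i. i \<in> d \<Longrightarrow> i \<le> m" using fin d(1) by (auto simp: m_def)
    have mk: "m \<le> k" using m d False by fastforce
    \<comment> \<open>The shift \<open>k - m\<close> moves the leading exponent \<open>m\<close> of
      the dependency to \<open>k\<close>.\<close>
    have eq: "(T ^^ (k - m)) (kry d) = (\<lambda>u. (T ^^ k) one u + (\<Sum>i\<in>d - {m}. 1 * (T ^^ (k - m + i)) one u))"
      unfolding kry_alt pow_sum using m(1) mk fin
      by (subst sum.remove[of _ m]) (auto simp flip: funpow_add comp_apply[of "T ^^ _" "T ^^ _"])
    have "short_kry (\<lambda>u. \<Sum>i\<in>d - {m}. 1 * (T ^^ (k - m + i)) one u)"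
    proof (rule short_kry_sum)
      fix i assume i: "i \<in> d - {m}"
      then have "i < m" using m by fastforce
      then show "short_kry ((T ^^ (k - m + i)) one)"
        using less.IH[of "k - m + i"] mk i d(2) by fastforce
    qed (use fin in auto)
    moreover have "gauss_even ((T ^^ k) one u - (\<Sum>i\<in>d - {m}. 1 * (T ^^ (k - m + i)) one u))" if "u < n" for u
    proof -
      have "gauss_even ((T ^^ (k - m)) (kry d) u)"
        by (rule gauss_even_pow) (use gvec_kry d that in auto)
      then show ?thesis unfolding eq
        by (subst (asm) gauss_even_add) (auto simp: gauss_even_diff gvec_pow gauss_ints_sum)
    qed
    moreover have "gvec ((T ^^ k) one)" by (simp add: gvec_pow)
    ultimately show ?thesis using short_kry_cong by blast
  qed
qed

text \<open>Off-diagonal terms come in equal pairs of even numbers and vanish modulo 4.\<close>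

lemma sum_s_double_mod_4:
  assumes fin: "finite c" and c: "\<And>i. i \<in> c \<Longrightarrow> i \<ge> n mod 2"
  shows "4 dvd (\<Sum>i\<in>c. \<Sum>j\<in>c. s (i + k + j)) - (\<Sum>i\<in>c. s (2 * i + k))"
  using assms
proof (induction c rule: finite_induct)
  case (insert x c)
  have "even (\<Sum>i\<in>c. s (i + k + x))"
    using insert.prems by (intro dvd_sum even_s') (simp add: trans_le_add2)
  then obtain r where r: "(\<Sum>i\<in>c. s (i + k + x)) = 2 * r" by (elim evenE)
  have "(\<Sum>j\<in>c. s (x + k + j)) = (\<Sum>i\<in>c. s (i + k + x))" by (simp add: ac_simps)
  moreover have double: "s (x + k + x) = s (2 * x + k)" by (rule arg_cong[of _ _ s]) simp
  ultimately have eq: "(\<Sum>i\<in>insert x c. \<Sum>j\<in>insert x c. s (i + k + j)) - (\<Sum>i\<in>insert x c. s (2 * i + k)) =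
      ((\<Sum>i\<in>c. \<Sum>j\<in>c. s (i + k + j)) - (\<Sum>i\<in>c. s (2 * i + k))) + 4 * r"
    using insert.hyps r double by (simp add: sum.distrib)
  have "4 dvd ((\<Sum>i\<in>c. \<Sum>j\<in>c. s (i + k + j)) - (\<Sum>i\<in>c. s (2 * i + k)))"
    using insert by auto
  then show ?case unfolding eq by simp
qed simp

text \<open>Put \<open>v = kry c + p * z\<close>. The condition modulo 2 controls \<open>z\<close>
  modulo \<open>1 + \<i>\<close>; expanding the form of \<open>v\<close>, everything involving
  \<open>z\<close> is then divisible by 4, and only the double sum for \<open>kry c\<close>
  survives.\<close>

lemma short_kry_isotropic:
  assumes v: "gvec v" and c: "c \<subseteq> {n mod 2..<n mod 2 + n div 2}"
    and cong: "\<And>u. u < n \<Longrightarrow> gauss_even (v u - kry c u)"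
    and one_v: "\<And>k. 2 gdvd ip one ((T ^^ k) v)"
    and v_v: "\<And>k. 4 gdvd ip v ((T ^^ k) v)"
  shows "4 dvd (\<Sum>i\<in>c. s (2 * i + k))"
proof -
  have fin: "finite c" using c finite_subset by blast
  define p where "p = 1 + \<i>"
  \<comment> \<open>From index \<open>n\<close> on any Gaussian integer will do, so that
    \<open>z\<close> is Gaussian everywhere.\<close>
  have "\<forall>u. \<exists>r. r \<in> gauss_ints \<and> (u < n \<longrightarrow> v u - kry c u = p * r)"
    using cong unfolding gauss_dvd_def p_def by (metis gauss_ints_0)
  then obtain z where z: "gvec z" "\<And>u. u < n \<Longrightarrow> v u - kry c u = p * z u" by metis
  define v' where "v' u = kry c u + p * z u" for u
  have vv': "v u = v' u" if "u < n" for u using z(2)[OF that] by (simp add: v'_def algebra_simps)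
  have pow: "(T ^^ j) v' = (\<lambda>u. (T ^^ j) (kry c) u + p * (T ^^ j) z u)" for j
    unfolding v'_def by (rule pow_add_smult)
  \<comment> \<open>The contribution of \<open>kry c\<close> is even since \<open>c\<close> avoids 0
    for odd \<open>n\<close>; one factor \<open>1 + \<i>\<close> is then cancelled from a multiple
    of 2.\<close>
  have one_z: "gauss_even (ip one ((T ^^ j) z))" for j
  proof (rule two_gdvd_one_plus_i_mult)
    have "ip one ((T ^^ j) v) = ip one ((T ^^ j) v')"
      by (intro ip_cong pow_cong refl) (use vv' in auto)
    also have "\<dots> = ip one ((T ^^ j) (kry c)) + p * ip one ((T ^^ j) z)"
      unfolding pow ip_add_smult_right ..
    finally have *: "(1 + \<i>) * ip one ((T ^^ j) z) = ip one ((T ^^ j) v) - ip one ((T ^^ j) (kry c))"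
      by (simp add: p_def)
    have "kry {0} = one" by (auto simp: kry_def)
    then have "ip one ((T ^^ j) (kry c)) = of_int (\<Sum>i\<in>c. s (j + i))"
      using ip_kry_kry[of "{0}" j c] by simp
    moreover have "even (\<Sum>i\<in>c. s (j + i))"
      by (intro dvd_sum even_s') (use c in \<open>auto intro: order_trans\<close>)
    ultimately obtain r :: int where r: "ip one ((T ^^ j) (kry c)) = of_int (2 * r)" by (metis evenE)
    obtain g where g: "g \<in> gauss_ints" "ip one ((T ^^ j) v) = 2 * g"
      using one_v by (auto simp: gauss_dvd_def)
    have "(1 + \<i>) * ip one ((T ^^ j) z) = 2 * (g - of_int r)" unfolding * r g by simp
    moreover have "g - of_int r \<in> gauss_ints" using g by (intro gauss_ints_closed) auto
    ultimately show "2 gdvd (1 + \<i>) * ip one ((T ^^ j) z)"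
      unfolding gauss_dvd_def by blast
  qed
  have z_z: "gauss_even (ip z ((T ^^ k) z))" by (intro gauss_even_ip_pow z one_z)
  obtain zz :: int where zz: "ip z ((T ^^ k) z) = of_int zz" using ip_pow_int[OF z(1)] by blast
  have "even zz" using z_z unfolding zz by simp
  then obtain z2 where z2: "zz = 2 * z2" by (elim evenE)
  have kz: "ip (kry c) ((T ^^ k) z) = (\<Sum>i\<in>c. ip one ((T ^^ (i + k)) z))"
    unfolding kry_def ip_sum_left by (simp add: ip_pow funpow_add)
  have "gauss_even (ip (kry c) ((T ^^ k) z))"
    unfolding kz by (intro gauss_even_sum fin one_z ip_gauss gvec_pow z) simp
  then obtain g where g: "g \<in> gauss_ints" "ip (kry c) ((T ^^ k) z) = p * g"
    by (auto simp: gauss_dvd_def p_def)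
  have zk: "ip z ((T ^^ k) (kry c)) = cnj (p * g)"
    unfolding g(2)[symmetric] cnj_ip by (simp add: ip_pow)
  obtain gr gi where gri: "g = Complex (of_int gr) (of_int gi)" using g(1) by (rule gauss_ints_cases)
  have "ip v ((T ^^ k) v) = ip v' ((T ^^ k) v')"
    by (intro ip_cong pow_cong) (use vv' in auto)
  also have "\<dots> = ip (kry c) ((T ^^ k) (kry c)) + p * ip (kry c) ((T ^^ k) z)
      + cnj p * (ip z ((T ^^ k) (kry c)) + p * ip z ((T ^^ k) z))"
    unfolding pow ip_add_smult_right unfolding v'_def ip_add_smult_left by (simp add: algebra_simps)
  also have "\<dots> = of_int (\<Sum>i\<in>c. \<Sum>j\<in>c. s (i + k + j)) + (p * (p * g) + cnj (p * (p * g)) + of_int (2 * zz))"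
    unfolding ip_kry_kry zz g zk by (simp add: p_def algebra_simps complex_eq_iff)
  \<comment> \<open>Since \<open>p * p = 2 * \<i>\<close>, the cross terms add up to
    \<open>- 4 * gi\<close>; the form of \<open>z\<close> is the even number \<open>zz\<close>,
    taken with coefficient \<open>cnj p * p = 2\<close>.\<close>
  also have "p * (p * g) + cnj (p * (p * g)) + of_int (2 * zz) = of_int (4 * (z2 - gi))"
    unfolding gri z2 p_def by (simp add: complex_eq_iff)
  finally have "4 gdvd of_int ((\<Sum>i\<in>c. \<Sum>j\<in>c. s (i + k + j)) + 4 * (z2 - gi))"
    using v_v[of k] by simp
  then have "4 dvd (\<Sum>i\<in>c. \<Sum>j\<in>c. s (i + k + j)) + 4 * (z2 - gi)"
    using gdvd_of_int[of 4] by simp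
  then have "4 dvd (\<Sum>i\<in>c. \<Sum>j\<in>c. s (i + k + j))" by (simp only: dvd_add_left_iff dvd_triv_left)
  moreover have "4 dvd (\<Sum>i\<in>c. \<Sum>j\<in>c. s (i + k + j)) - (\<Sum>i\<in>c. s (2 * i + k))"
    by (rule sum_s_double_mod_4) (use fin c in auto)
  ultimately show ?thesis by (metis dvd_diff_commute dvd_diffD1 dvd_diff_right_iff)
qed

end

section \<open>The walk matrix and its Gram matrix\<close>

text \<open>The adjugate inverts an integer matrix up to its determinant, hence modulo 2 when the
  determinant is odd, while all entries stay integral.\<close>

lemma adj_mat_sums:
  fixes M :: "'a :: comm_ring_1 mat"
  assumes M: "M \<in> carrier_mat n n" and ij: "i < n" "j < n"
  shows "(\<Sum>k<n. M $$ (i, k) * adj_mat M $$ (k, j)) = (if i = j then det M else 0)"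
    and "(\<Sum>k<n. adj_mat M $$ (i, k) * M $$ (k, j)) = (if i = j then det M else 0)"
proof -
  note adj = adj_mat[OF M]
  have "(M * adj_mat M) $$ (i, j) = (\<Sum>k<n. M $$ (i, k) * adj_mat M $$ (k, j))"
    using M adj(1) ij by (simp add: scalar_prod_def lessThan_atLeast0)
  then show "(\<Sum>k<n. M $$ (i, k) * adj_mat M $$ (k, j)) = (if i = j then det M else 0)"
    unfolding adj(2) using ij by (simp split: if_splits)
  have "(adj_mat M * M) $$ (i, j) = (\<Sum>k<n. adj_mat M $$ (i, k) * M $$ (k, j))"
    using M adj(1) ij by (simp add: scalar_prod_def lessThan_atLeast0)
  then show "(\<Sum>k<n. adj_mat M $$ (i, k) * M $$ (k, j)) = (if i = j then det M else 0)"
    unfolding adj(3) using ij by (simp split: if_splits)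
qed

lemma det_map_cnj: "det (map_mat cnj A) = cnj (det A)"
proof -
  interpret comm_ring_hom cnj by unfold_locales auto
  show ?thesis by (rule hom_det)
qed

context gauss_hermitian
begin

definition walk :: "complex mat" where
  "walk = mat n n (\<lambda>(u, k). (T ^^ k) one u)"

definition walk_adj :: "complex mat" where
  "walk_adj = mat n n (\<lambda>(k, u). cnj ((T ^^ k) one u))"

lemma walk_carrier [simp]: "walk \<in> carrier_mat n n" "walk_adj \<in> carrier_mat n n"
  by (simp_all add: walk_def walk_adj_def)

lemma det_walk_adj: "det walk_adj = cnj (det walk)"
proof -
  have "walk_adj = transpose_mat (map_mat cnj walk)"
    by (rule eq_matI) (auto simp: walk_def walk_adj_def)
  then show ?thesis by (simp add: det_transpose[of _ n] det_map_cnj)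
qed

text \<open>For odd \<open>n\<close> row 0 of the Gram matrix contains the odd entry
  \<open>s 0 = n\<close>, so it alone has no factor 2 to give.\<close>

definition row_factor :: "nat \<Rightarrow> int" where
  "row_factor j = (if odd n \<and> j = 0 then 1 else 2)"

text \<open>The Gram matrix \<open>s (j + k)\<close> of the walk vectors, with the evident factors 2 removed from its rows.\<close>

definition half_gram :: "int mat" where
  "half_gram = mat n n (\<lambda>(j, k). if odd n \<and> j = 0 then s k else s (j + k) div 2)"

lemma half_gram_carrier [simp]: "half_gram \<in> carrier_mat n n"
  by (simp add: half_gram_def)

lemma row_factor_half_gram:
  assumes "j < n" "k < n"
  shows "row_factor j * half_gram $$ (j, k) = s (j + k)"
proof (cases "odd n \<and> j = 0")
  case False
  then have "even (s (j + k))" by (intro even_s') presburger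
  then show ?thesis using assms False by (auto simp: row_factor_def half_gram_def)
qed (use assms in \<open>simp add: row_factor_def half_gram_def\<close>)

lemma prod_row_factor: "(\<Prod>j<n. row_factor j) = 2 ^ (2 * (n div 2))"
proof (cases "odd n")
  case True
  then obtain m where m: "n = Suc (2 * m)" by (auto elim: oddE)
  have "(\<Prod>j<Suc (2 * m). row_factor j) = row_factor 0 * (\<Prod>j<2 * m. row_factor (Suc j))"
    by (rule prod.lessThan_Suc_shift)
  then have "(\<Prod>j<n. row_factor j) = row_factor 0 * (\<Prod>j<2 * m. row_factor (Suc j))"
    using m by (simp only:)
  also have "\<dots> = 2 ^ (2 * m)" using True by (simp add: row_factor_def)
  finally show ?thesis using m by simp
qed (simp add: row_factor_def)

text \<open>The matrix \<open>walk_adj * walk\<close> has entries \<open>s (j + k)\<close>;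
  splitting off the diagonal matrix \<open>D\<close> of row factors gives the power of 2.\<close>

lemma norm_det_walk: "of_int (2 ^ (2 * (n div 2)) * det half_gram) = cnj (det walk) * det walk"
proof -
  define D where "D = mat n n (\<lambda>(i, j). if i = j then row_factor i else 0)"
  have D: "D \<in> carrier_mat n n" by (simp add: D_def)
  have "det D = prod_list (diag_mat D)"
    by (rule det_upper_triangular[OF _ D]) (auto simp: D_def)
  also have "\<dots> = (\<Prod>j<n. row_factor j)"
    unfolding prod_list_diag_prod by (auto simp: D_def lessThan_atLeast0 intro!: prod.cong)
  finally have detD: "det D = 2 ^ (2 * (n div 2))" by (simp add: prod_row_factor)
  have entry: "(D * half_gram) $$ (j, k) = s (j + k)" if "j < n" "k < n" for j k
  proof -
    have "(D * half_gram) $$ (j, k) = (\<Sum>i\<in>{0..<n}. (if j = i then row_factor j else 0) * half_gram $$ (i, k))"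
      using that by (simp add: scalar_prod_def D_def half_gram_def)
    also have "\<dots> = (\<Sum>i\<in>{0..<n}. if i = j then row_factor j * half_gram $$ (j, k) else 0)"
      by (intro sum.cong) auto
    also have "\<dots> = s (j + k)" using that row_factor_half_gram by simp
    finally show ?thesis .
  qed
  have "walk_adj * walk = map_mat of_int (D * half_gram)"
  proof (rule eq_matI)
    fix j k assume "j < dim_row (map_mat complex_of_int (D * half_gram))" "k < dim_col (map_mat complex_of_int (D * half_gram))"
    then have jk: "j < n" "k < n" using D by (auto simp: half_gram_def)
    have "(walk_adj * walk) $$ (j, k) = ip ((T ^^ j) one) ((T ^^ k) one)"
      using jk by (simp add: walk_def walk_adj_def scalar_prod_def ip_def lessThan_atLeast0)
    also have "\<dots> = of_int (s (j + k))" by (simp add: of_int_s ip_pow_pow)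
    finally show "(walk_adj * walk) $$ (j, k) = map_mat of_int (D * half_gram) $$ (j, k)"
      using entry jk D by (simp add: half_gram_def)
  qed (auto simp: walk_def walk_adj_def D_def half_gram_def)
  then have "det walk_adj * det walk = det (map_mat complex_of_int (D * half_gram))"
    using det_mult[of walk_adj n walk] by simp
  also have "\<dots> = of_int (det (D * half_gram))" by (rule of_int_hom.hom_det)
  also have "det (D * half_gram) = 2 ^ (2 * (n div 2)) * det half_gram"
    using det_mult[OF D, of half_gram] detD by simp
  finally show ?thesis by (simp add: det_walk_adj)
qed

text \<open>The inner products are the coordinates of the nonsingular matrix \<open>walk_adj\<close>
  applied to \<open>r\<close>.\<close>

lemma walk_separates:
  assumes "det walk \<noteq> 0" "\<And>k. k < n \<Longrightarrow> ip ((T ^^ k) one) r = 0" "u < n"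
  shows "r u = 0"
proof -
  have "det walk_adj \<noteq> 0" using assms by (simp add: det_walk_adj)
  moreover have "walk_adj *\<^sub>v vec n r = 0\<^sub>v n"
    using assms(2) by (intro eq_vecI) (auto simp: walk_adj_def scalar_prod_def ip_def lessThan_atLeast0)
  ultimately have "vec n r = 0\<^sub>v n"
    using det_0_iff_vec_prod_zero[of walk_adj n] by (metis vec_carrier walk_carrier(2))
  then show ?thesis using assms(3) by (metis index_vec index_zero_vec(1))
qed

text \<open>Cramer's rule without division: the adjugate of \<open>half_gram\<close> turns the
  rescaled inner products \<open>x\<close> into coefficients \<open>y\<close> whose Krylov
  combination \<open>w\<close> is exactly \<open>det half_gram\<close> times \<open>v\<close>. An
  odd determinant is 1 modulo \<open>1 + \<i>\<close>.\<close>

lemma short_kry_if_odd_det: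
  assumes det: "det walk \<noteq> 0" and odd: "odd (det half_gram)" and v: "gvec v"
    and one_v: "\<And>k. 2 gdvd ip one ((T ^^ k) v)"
  shows "short_kry v"
proof -
  define x where "x k = ip ((T ^^ k) one) v / of_int (row_factor k)" for k
  have x_gauss: "x k \<in> gauss_ints" for k
    using one_v[of k] ip_gauss[of one v] v
    by (auto simp: x_def row_factor_def ip_pow gauss_dvd_def)
  have x: "of_int (row_factor k) * x k = ip ((T ^^ k) one) v" for k
    by (simp add: x_def row_factor_def)
  define y where "y k = (\<Sum>j<n. of_int (adj_mat half_gram $$ (k, j)) * x j)" for k
  have y_gauss: "y k \<in> gauss_ints" for k
    unfolding y_def by (intro gauss_ints_sum gauss_ints_closed x_gauss) auto
  have My: "(\<Sum>k<n. of_int (half_gram $$ (j, k)) * y k) = of_int (det half_gram) * x j" if "j < n" for j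
  proof -
    have "(\<Sum>k<n. of_int (half_gram $$ (j, k)) * y k) =
        (\<Sum>i<n. of_int (\<Sum>k<n. half_gram $$ (j, k) * adj_mat half_gram $$ (k, i)) * x i)"
      unfolding y_def sum_distrib_left by (subst sum.swap) (simp add: sum_distrib_left sum_distrib_right ac_simps)
    also have "\<dots> = (\<Sum>i<n. if i = j then of_int (det half_gram) * x j else 0)"
      using that by (intro sum.cong refl) (auto simp del: of_int_sum simp: adj_mat_sums(1)[OF half_gram_carrier])
    finally show ?thesis using that by simp
  qed
  define w where "w u = (\<Sum>k<n. y k * (T ^^ k) one u)" for u
  have w: "w u = of_int (det half_gram) * v u" if "u < n" for u
  proof -
    define r where "r u = w u + (- of_int (det half_gram)) * v u" for u
    have "ip ((T ^^ j) one) r = 0" if j: "j < n" for j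
    proof -
      have "ip ((T ^^ j) one) w = (\<Sum>k<n. y k * of_int (s (j + k)))"
        unfolding w_def ip_sum_right by (simp add: ip_pow_pow of_int_s)
      also have "\<dots> = of_int (row_factor j) * (\<Sum>k<n. of_int (half_gram $$ (j, k)) * y k)"
        unfolding sum_distrib_left
        by (intro sum.cong refl) (use j in \<open>simp add: row_factor_half_gram[symmetric]\<close>)
      also have "\<dots> = of_int (det half_gram) * ip ((T ^^ j) one) v"
        unfolding My[OF j] x[symmetric] by simp
      finally show ?thesis unfolding r_def ip_add_smult_right by simp
    qed
    then have "r u = 0" using walk_separates[OF det] that by blast
    then show ?thesis by (simp add: r_def)
  qed
  \<comment> \<open>For odd \<open>n\<close> the exponent 0 lies below the window, so its
    coefficient has to vanish modulo \<open>1 + \<i>\<close>. In row 0 of the linear system the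
    right side is even, because \<open>x 0\<close> was not halved, and \<open>s 0 = n\<close> is the
    only odd coefficient.\<close>
  have y0: "gauss_even (y 0)" if n: "odd n"
  proof -
    have n0: "0 < n" using n by (cases n) auto
    have "gauss_even (x 0)"
      using two_gdvd_imp_gauss_even[OF one_v[of 0]] n by (simp add: x_def row_factor_def)
    then have "gauss_even (\<Sum>k<n. of_int (half_gram $$ (0, k)) * y k)"
      unfolding My[OF n0] using x_gauss by (simp add: gauss_even_mult)
    also have "(\<Sum>k<n. of_int (half_gram $$ (0, k)) * y k) = (\<Sum>k<n. of_int (s k) * y k)"
      using n n0 by (intro sum.cong) (auto simp: half_gram_def)
    also have "\<dots> = of_int (s 0) * y 0 + (\<Sum>k\<in>{..<n} - {0}. of_int (s k) * y k)"
      using n0 by (intro sum.remove) auto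
    finally have "gauss_even (of_int (s 0) * y 0 + (\<Sum>k\<in>{..<n} - {0}. of_int (s k) * y k))" .
    moreover have "gauss_even (\<Sum>k\<in>{..<n} - {0}. of_int (s k) * y k)"
      by (intro gauss_even_sum) (auto simp: gauss_even_mult y_gauss even_s intro!: gauss_ints_closed)
    ultimately have "gauss_even (of_int (s 0) * y 0)"
      using y_gauss by (subst (asm) gauss_even_add) (auto intro!: gauss_ints_sum gauss_ints_closed)
    then have "gauss_even (of_int (s 0)) \<or> gauss_even (y 0)"
      using y_gauss by (simp only: gauss_even_mult gauss_ints_of_int)
    then show ?thesis using n unfolding gauss_even_of_int s_0 by simp
  qed
  have "short_kry (\<lambda>u. y k * (T ^^ k) one u)" if "k < n" for k
  proof (cases "k \<ge> n mod 2")
    case True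
    then show ?thesis by (intro short_kry_smult short_kry_pow_one y_gauss)
  next
    case False
    then have "k = 0" "odd n" by presburger+
    then show ?thesis
      using y0 y_gauss by (intro short_kry_cong[OF short_kry_0]) auto
  qed
  then have "short_kry (\<lambda>u. \<Sum>k<n. 1 * (y k * (T ^^ k) one u))"
    by (intro short_kry_sum) auto
  then have "short_kry w" unfolding w_def by simp
  then show ?thesis
  proof (rule short_kry_cong[OF _ v])
    fix u assume "u < n"
    then show "gauss_even (v u - w u)"
      using w odd v by (simp add: gauss_even_diff gauss_even_mult gauss_ints_closed)
  qed
qed

text \<open>The isotropy congruences become a linear relation modulo 2 between the columns
  \<open>2 * i\<close> of \<open>half_gram\<close>. An odd determinant forces \<open>c = {}\<close>,
  and \<open>kry {}\<close> is zero.\<close>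

lemma gauss_even_if_odd_det:
  assumes det: "det walk \<noteq> 0" and odd: "odd (det half_gram)" and v: "gvec v"
    and one_v: "\<And>k. 2 gdvd ip one ((T ^^ k) v)"
    and v_v: "\<And>k. 4 gdvd ip v ((T ^^ k) v)"
    and u: "u < n"
  shows "gauss_even (v u)"
proof -
  obtain c where c: "c \<subseteq> {n mod 2..<n mod 2 + n div 2}" "\<And>u. u < n \<Longrightarrow> gauss_even (v u - kry c u)"
    using short_kry_if_odd_det[OF det odd v one_v] unfolding short_kry_def by blast
  have fin: "finite c" using c finite_subset by blast
  \<comment> \<open>The window ends early enough for \<open>2 * i\<close> to be a column index of
    \<open>half_gram\<close>.\<close>
  have c_less: "2 * i < n" if "i \<in> c" for i
  proof -
    have "i < n mod 2 + n div 2" using c that by auto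
    then show ?thesis by presburger
  qed
  \<comment> \<open>In the unhalved row 0 for odd \<open>n\<close>, evenness of \<open>s\<close>
    suffices; the halved rows need divisibility by 4.\<close>
  have "even (\<Sum>i\<in>c. half_gram $$ (k, 2 * i))" if k: "k < n" for k
  proof (cases "odd n \<and> k = 0")
    case True
    have "half_gram $$ (k, 2 * i) = s (2 * i)" if "i \<in> c" for i
      using True c_less[OF that] k by (simp add: half_gram_def)
    moreover have "even (s (2 * i))" if "i \<in> c" for i
    proof -
      have "i \<ge> n mod 2" using c that by auto
      then show ?thesis by (intro even_s') linarith
    qed
    ultimately show ?thesis by (intro dvd_sum) auto
  next
    case False
    have "2 * half_gram $$ (k, 2 * i) = s (2 * i + k)" if "i \<in> c" for i
      using row_factor_half_gram[OF k c_less[OF that]] False by (auto simp: row_factor_def ac_simps)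
    then have "2 * (\<Sum>i\<in>c. half_gram $$ (k, 2 * i)) = (\<Sum>i\<in>c. s (2 * i + k))"
      by (simp add: sum_distrib_left)
    moreover have "4 dvd (\<Sum>i\<in>c. s (2 * i + k))"
      by (rule short_kry_isotropic[OF v c one_v v_v])
    ultimately show ?thesis by presburger
  qed
  then have "even (\<Sum>k<n. adj_mat half_gram $$ (m, k) * (\<Sum>i\<in>c. half_gram $$ (k, 2 * i)))" for m
    by (auto intro!: dvd_sum[of "{..<n}"] dvd_mult simp del: even_sum_iff)
  also have "(\<Sum>k<n. adj_mat half_gram $$ (m, k) * (\<Sum>i\<in>c. half_gram $$ (k, 2 * i))) =
      (\<Sum>i\<in>c. \<Sum>k<n. adj_mat half_gram $$ (m, k) * half_gram $$ (k, 2 * i))" for m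
    unfolding sum_distrib_left by (rule sum.swap)
  finally have ev: "even (\<Sum>i\<in>c. \<Sum>k<n. adj_mat half_gram $$ (m, k) * half_gram $$ (k, 2 * i))" for m .
  have "c = {}"
  proof (rule ccontr)
    assume "c \<noteq> {}"
    then obtain i where i: "i \<in> c" by auto
    \<comment> \<open>Row \<open>2 * i\<close> of the adjugate isolates the single column
      \<open>2 * i\<close> of the relation.\<close>
    have "(\<Sum>j\<in>c. \<Sum>k<n. adj_mat half_gram $$ (2 * i, k) * half_gram $$ (k, 2 * j)) =
        (\<Sum>j\<in>c. if j = i then det half_gram else 0)"
      using adj_mat_sums(2)[OF half_gram_carrier c_less[OF i] c_less] by (intro sum.cong) auto
    also have "\<dots> = det half_gram" using i fin by simp
    finally show False using ev[of "2 * i"] odd by simp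
  qed
  then show ?thesis using c(2)[OF u] by (simp add: kry_def)
qed

end

section \<open>Self-conversity and the power of 2 in \<open>det walk\<close>\<close>

lemma gauss_ints_prod: "(\<And>x. x \<in> F \<Longrightarrow> f x \<in> gauss_ints) \<Longrightarrow> prod f F \<in> gauss_ints"
  by (induction F rule: infinite_finite_induct) (auto intro: gauss_ints_closed)

text \<open>Removing \<open>2 ^ h\<close> from \<open>m\<close> leaves a number with square
  \<open>q\<close>, and \<open>q\<close> is even.\<close>

lemma power_two_dvd_if_square:
  fixes m q :: int
  assumes "m\<^sup>2 = 2 ^ (2 * h) * q" "even q"
  shows "2 ^ (h + 1) dvd m"
proof -
  have "(2 ^ h)\<^sup>2 dvd m\<^sup>2" using assms by (simp add: power_mult[symmetric] mult.commute[of h])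
  then have "2 ^ h dvd m" by (simp only: pow_divides_pow_iff zero_less_numeral)
  then obtain r where r: "m = 2 ^ h * r" by (elim dvdE)
  have "2 ^ (2 * h) * r\<^sup>2 = 2 ^ (2 * h) * q"
    using assms(1) by (simp add: r power_mult_distrib power_mult[symmetric] mult.commute[of h])
  then have "even (r\<^sup>2)" using assms(2) by simp
  then have "even r" by simp
  then show ?thesis by (auto simp: r)
qed

context gauss_hermitian
begin

lemma det_walk_gauss: "det walk \<in> gauss_ints"
  unfolding det_def'[OF walk_carrier(1)]
proof (intro gauss_ints_sum gauss_ints_closed gauss_ints_prod)
  fix p :: "nat \<Rightarrow> nat" and i
  assume "p \<in> {p. p permutes {0..<n}}" "i \<in> {0..<n}"
  then have "i < n" "p i < n" using permutes_in_image[of p "{0..<n}" i] by auto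
  then show "walk $$ (i, p i) \<in> gauss_ints" using gvec_pow[of one] by (simp add: walk_def)
qed (auto simp: sign_def)

context
  fixes f
  assumes f: "bij_betw f {..<n} {..<n}"
    and a_f: "\<And>u v. u < n \<Longrightarrow> v < n \<Longrightarrow> a (f u) (f v) = cnj (a u v)"
begin

text \<open>The all-one vector is fixed by relabelling and by conjugation; reindexing the row sums
  along \<open>f\<close> carries this through all powers.\<close>

lemma pow_one_converse: "u < n \<Longrightarrow> (T ^^ k) one (f u) = cnj ((T ^^ k) one u)"
proof (induction k arbitrary: u)
  case (Suc k)
  have "(T ^^ Suc k) one (f u) = (\<Sum>v<n. a (f u) (f v) * (T ^^ k) one (f v))"
    unfolding funpow.simps comp_apply T_def[of "(T ^^ k) one"]
    by (rule sum.reindex_bij_betw[OF f, symmetric])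
  also have "\<dots> = cnj ((T ^^ Suc k) one u)"
    using Suc by (simp add: T_def[of "(T ^^ k) one"] a_f)
  finally show ?case .
qed simp

text \<open>Conjugating \<open>walk\<close> permutes its rows, so the determinant changes at most in
  sign.\<close>

lemma cnj_det_walk: "cnj (det walk) = det walk \<or> cnj (det walk) = - det walk"
proof -
  \<comment> \<open>\<open>f\<close> is arbitrary outside the vertex set; \<open>permutes\<close>
    asks for the identity there.\<close>
  define p where "p u = (if u \<in> {0..<n} then f u else u)" for u
  have "bij_betw p {0..<n} {0..<n}"
    using f by (subst bij_betw_cong[of _ _ f]) (auto simp: p_def lessThan_atLeast0)
  then have p: "p permutes {0..<n}"
    by (rule bij_imp_permutes) (auto simp: p_def)
  have "map_mat cnj walk = mat n n (\<lambda>(i, j). walk $$ (p i, j))"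
  proof (rule eq_matI)
    fix i j assume "i < dim_row (mat n n (\<lambda>(i, j). walk $$ (p i, j)))" "j < dim_col (mat n n (\<lambda>(i, j). walk $$ (p i, j)))"
    then have ij: "i < n" "j < n" by auto
    then have "p i < n" using permutes_in_image[OF p, of i] by simp
    then show "map_mat cnj walk $$ (i, j) = mat n n (\<lambda>(i, j). walk $$ (p i, j)) $$ (i, j)"
      using ij pow_one_converse[of i j] by (simp add: walk_def p_def)
  qed (auto simp: walk_def)
  then have "cnj (det walk) = signof p * det walk"
    using det_permute_rows[OF walk_carrier(1) p] by (simp flip: det_map_cnj)
  then show ?thesis by (auto simp: sign_def split: if_splits)
qed

text \<open>A real or purely imaginary \<open>det walk\<close> is a unit times an integer
  \<open>m\<close>, and the Gram determinant is \<open>m\<^sup>2\<close>.\<close>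

lemma power_two_gdvd_det_walk:
  assumes "even (det half_gram)"
  shows "2 ^ (n div 2 + 1) gdvd det walk"
proof -
  obtain x y where xy: "det walk = Complex (of_int x) (of_int y)"
    using det_walk_gauss by (rule gauss_ints_cases)
  have "\<exists>\<epsilon>\<in>gauss_ints. \<exists>m::int. det walk = \<epsilon> * of_int m \<and> cnj \<epsilon> * \<epsilon> = 1"
    using cnj_det_walk
  proof
    assume "cnj (det walk) = det walk"
    then have "det walk = 1 * of_int x" by (simp add: xy complex_eq_iff)
    then show ?thesis by (intro bexI[of _ 1] exI[of _ x]) auto
  next
    assume "cnj (det walk) = - det walk"
    then have "det walk = \<i> * of_int y" by (simp add: xy complex_eq_iff)
    then show ?thesis by (intro bexI[of _ \<i>] exI[of _ y]) auto
  qed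
  then obtain \<epsilon> m where m: "\<epsilon> \<in> gauss_ints" "det walk = \<epsilon> * of_int m" "cnj \<epsilon> * \<epsilon> = 1"
    by blast
  have "cnj (det walk) * det walk = (cnj \<epsilon> * \<epsilon>) * of_int (m\<^sup>2)"
    unfolding m(2) by (simp add: power2_eq_square)
  then have "complex_of_int (m\<^sup>2) = of_int (2 ^ (2 * (n div 2)) * det half_gram)"
    unfolding m(3) norm_det_walk[symmetric] by (simp only: mult_1)
  then have "m\<^sup>2 = 2 ^ (2 * (n div 2)) * det half_gram"
    by (simp only: of_int_eq_iff)
  then have "2 ^ (n div 2 + 1) dvd m" using assms by (rule power_two_dvd_if_square)
  then obtain r where "m = 2 ^ (n div 2 + 1) * r" by (elim dvdE)
  then have "det walk = 2 ^ (n div 2 + 1) * (\<epsilon> * of_int r)" by (simp add: m(2))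
  moreover have "\<epsilon> * of_int r \<in> gauss_ints" using m(1) by (intro gauss_ints_closed) auto
  ultimately show ?thesis unfolding gauss_dvd_def by blast
qed

end

text \<open>From AU = UB it follows that the k-th power of A times U is U times that of B; the
  witness \<open>g\<close> is column \<open>j\<close> of the k-th power of \<open>B\<close>.\<close>

lemma pow_unitary_column:
  assumes eq: "\<And>u j. u < n \<Longrightarrow> j < n \<Longrightarrow> (\<Sum>v<n. a u v * U v j) = (\<Sum>m<n. U u m * B m j)"
    and B: "\<And>m j. m < n \<Longrightarrow> j < n \<Longrightarrow> B m j \<in> gauss_ints" and j: "j < n"
  shows "\<exists>g. gvec g \<and> (\<forall>u<n. (T ^^ k) (\<lambda>u. U u j) u = (\<Sum>m<n. g m * U u m))"
proof (induction k)
  case 0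
  have "(\<Sum>m<n. (if m = j then 1 else 0) * U u m) = U u j" for u
  proof -
    have "(\<Sum>m<n. (if m = j then 1 else 0) * U u m) = (\<Sum>m<n. if m = j then U u j else 0)"
      by (intro sum.cong) auto
    then show ?thesis using j by simp
  qed
  then show ?case by (intro exI[of _ "\<lambda>m. if m = j then 1 else 0"]) auto
next
  case (Suc k)
  then obtain g where g: "gvec g" "\<And>u. u < n \<Longrightarrow> (T ^^ k) (\<lambda>u. U u j) u = (\<Sum>m<n. g m * U u m)"
    by blast
  define g' where "g' i = (if i < n then \<Sum>m<n. g m * B i m else 0)" for i
  have "gvec g'"
    unfolding g'_def using g(1) B by (auto intro!: gauss_ints_sum gauss_ints_closed)
  moreover have "(T ^^ Suc k) (\<lambda>u. U u j) u = (\<Sum>m<n. g' m * U u m)" if u: "u < n" for u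
  proof -
    have "(T ^^ Suc k) (\<lambda>u. U u j) u = T (\<lambda>u. \<Sum>m<n. g m * U u m) u"
      using T_cong[of "(T ^^ k) (\<lambda>u. U u j)" "\<lambda>u. \<Sum>m<n. g m * U u m"] g(2) by simp
    also have "\<dots> = (\<Sum>m<n. g m * (\<Sum>i<n. U u i * B i m))"
      unfolding T_sum unfolding T_def using eq u by (intro sum.cong) auto
    also have "\<dots> = (\<Sum>i<n. g' i * U u i)"
      unfolding sum_distrib_left g'_def
      by (subst sum.swap) (auto simp: sum_distrib_left sum_distrib_right ac_simps intro!: sum.cong)
    finally show ?thesis .
  qed
  ultimately show ?case by blast
qed

text \<open>Let \<open>v\<close> be a column of lU. Column sums 1 make the inner product of
  \<open>one\<close> with each power of \<open>T\<close> at \<open>v\<close> a Gaussian multiple of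
  \<open>l\<close>; orthonormality makes that of \<open>v\<close> a multiple of
  \<open>l * cnj l\<close>. As 2 divides \<open>l\<close>, these are divisible by 2 and 4.\<close>

lemma unitary_column_gauss_even:
  assumes det: "det walk \<noteq> 0" and odd: "odd (det half_gram)"
    and eq: "\<And>u j. u < n \<Longrightarrow> j < n \<Longrightarrow> (\<Sum>v<n. a u v * U v j) = (\<Sum>m<n. U u m * B m j)"
    and B: "\<And>m j. m < n \<Longrightarrow> j < n \<Longrightarrow> B m j \<in> gauss_ints"
    and orth: "\<And>j m. j < n \<Longrightarrow> m < n \<Longrightarrow> (\<Sum>u<n. cnj (U u j) * U u m) = (if j = m then 1 else 0)"
    and col_sum: "\<And>m. m < n \<Longrightarrow> (\<Sum>u<n. U u m) = 1"
    and l: "2 gdvd l" and lU: "\<And>u j. u < n \<Longrightarrow> j < n \<Longrightarrow> l * U u j \<in> gauss_ints"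
    and u: "u < n" and j: "j < n"
  shows "gauss_even (l * U u j)"
proof -
  define v where "v u = (if u < n then l * U u j else 0)" for u
  have v: "gvec v" using lU j by (auto simp: v_def)
  obtain c where c: "c \<in> gauss_ints" "l = 2 * c" using l by (auto simp: gauss_dvd_def)
  have pow: "\<exists>g. gvec g \<and> (\<forall>u<n. (T ^^ k) v u = (\<Sum>m<n. l * g m * U u m))" for k
  proof -
    obtain g where g: "gvec g" "\<forall>u<n. (T ^^ k) (\<lambda>u. U u j) u = (\<Sum>m<n. g m * U u m)"
      using pow_unitary_column[OF eq B j] by blast
    have "(T ^^ k) v u = (T ^^ k) (\<lambda>u. 0 + l * U u j) u" if "u < n" for u
      by (rule pow_cong[OF _ that]) (simp add: v_def)
    also have "(T ^^ k) (\<lambda>u. 0 + l * U u j) u = l * (T ^^ k) (\<lambda>u. U u j) u" for u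
      \<comment> \<open>A sum over one index serves to pull out the scalar \<open>l\<close>.\<close>
      using pow_sum[of k "\<lambda>_. l" "\<lambda>_ u. U u j" "{0::nat}"] by simp
    finally show ?thesis using g by (intro exI[of _ g]) (auto simp: sum_distrib_left ac_simps)
  qed
  have "gauss_even (v u)"
  proof (rule gauss_even_if_odd_det[OF det odd v _ _ u])
    fix k
    obtain g where g: "gvec g" "\<forall>u<n. (T ^^ k) v u = (\<Sum>m<n. l * g m * U u m)" using pow by blast
    have "ip one ((T ^^ k) v) = ip one (\<lambda>u. \<Sum>m<n. l * g m * U u m)"
      by (rule ip_cong) (use g in auto)
    also have "\<dots> = (\<Sum>m<n. l * g m)"
      unfolding ip_sum_right by (simp add: ip_def col_sum)
    also have "\<dots> = 2 * (\<Sum>m<n. c * g m)" by (simp add: c(2) sum_distrib_left ac_simps)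
    finally show "2 gdvd ip one ((T ^^ k) v)"
      unfolding gauss_dvd_def using g(1) c(1) by (blast intro: gauss_ints_sum gauss_ints_closed)
    have "ip v ((T ^^ k) v) = ip (\<lambda>u. 0 + l * U u j) (\<lambda>u. \<Sum>m<n. l * g m * U u m)"
      by (rule ip_cong) (use g in \<open>auto simp: v_def\<close>)
    also have "\<dots> = (\<Sum>m<n. l * g m * (cnj l * (\<Sum>u<n. cnj (U u j) * U u m)))"
      unfolding ip_sum_right ip_add_smult_left by (simp add: ip_def)
    also have "\<dots> = (\<Sum>m<n. if m = j then l * g j * cnj l else 0)"
      by (intro sum.cong) (use orth j in auto)
    also have "\<dots> = 4 * (c * g j * cnj c)" using j by (simp add: c(2))
    finally show "4 gdvd ip v ((T ^^ k) v)"
      unfolding gauss_dvd_def using g(1) c(1) by (auto intro!: gauss_ints_closed)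
  qed
  then show ?thesis using u by (simp add: v_def)
qed

end

section \<open>Mixed graphs\<close>

definition graph_entry :: "mixed_graph \<Rightarrow> nat \<Rightarrow> nat \<Rightarrow> complex" where
  "graph_entry G u v =
     (if {u, v} \<in> uedges G then 1
      else if (u, v) \<in> arcs G then \<i>
      else if (v, u) \<in> arcs G then - \<i>
      else 0)"

lemma hermitian_adjacency_entry:
  "u < n \<Longrightarrow> v < n \<Longrightarrow> hermitian_adjacency n G $$ (u, v) = graph_entry G u v"
  by (simp add: hermitian_adjacency_def graph_entry_def)

lemma hermitian_adjacency_carrier [simp]: "hermitian_adjacency n G \<in> carrier_mat n n"
  by (simp add: hermitian_adjacency_def)

lemma graph_entry_gauss: "graph_entry G u v \<in> gauss_ints"
  by (simp add: graph_entry_def)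

lemma gauss_hermitian_graph_entry:
  assumes "G \<in> mixed_graphs n"
  shows "gauss_hermitian (graph_entry G)"
proof
  fix u v :: nat
  have asym: "(x, y) \<in> arcs G \<Longrightarrow> (y, x) \<notin> arcs G" for x y
    using assms by (auto simp: mixed_graphs_def)
  have comm: "{u, v} = {v, u}" by auto
  show "graph_entry G u v \<in> gauss_ints" by (rule graph_entry_gauss)
  show "cnj (graph_entry G u v) = graph_entry G v u"
    using asym comm by (auto simp: graph_entry_def)
  have "{u, u} \<notin> uedges G" "(u, u) \<notin> arcs G"
    using assms by (auto simp: mixed_graphs_def doubleton_eq_iff)
  then show "graph_entry G u u = 0" by (simp add: graph_entry_def)
qed

text \<open>Reversing arcs exchanges \<open>\<i>\<close> and \<open>- \<i>\<close>, which is
  conjugation of the entries.\<close>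

lemma self_converse_bij:
  assumes "G \<in> self_converse_graphs n"
  obtains f where "bij_betw f {..<n} {..<n}"
    "\<And>u v. u < n \<Longrightarrow> v < n \<Longrightarrow> graph_entry G (f u) (f v) = cnj (graph_entry G u v)"
proof -
  from assms obtain f where f: "bij_betw f {0..<n} {0..<n}"
    "\<forall>u<n. \<forall>v<n. {u, v} \<in> uedges G \<longleftrightarrow> {f u, f v} \<in> uedges G"
    "\<forall>u<n. \<forall>v<n. (u, v) \<in> arcs G \<longleftrightarrow> (f v, f u) \<in> arcs G"
    by (auto simp: self_converse_graphs_def isomorphic_mixed_def converse_graph_def)
  have G: "G \<in> mixed_graphs n" using assms by (simp add: self_converse_graphs_def)
  have "graph_entry G (f u) (f v) = cnj (graph_entry G u v)" if "u < n" "v < n" for u v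
    using f(2,3) that G by (auto simp: graph_entry_def mixed_graphs_def)
  then show thesis using that f(1) by (simp add: lessThan_atLeast0)
qed

context gauss_hermitian
begin

lemma pow_mat_mult_vec:
  assumes A: "A \<in> carrier_mat n n" "\<And>u v. u < n \<Longrightarrow> v < n \<Longrightarrow> A $$ (u, v) = a u v"
  shows "(A ^\<^sub>m k) *\<^sub>v vec n x = vec n ((T ^^ k) x)"
proof (induction k arbitrary: x)
  case 0
  then show ?case using A by simp
next
  case (Suc k)
  have "A *\<^sub>v vec n x = vec n (T x)"
    using A by (intro eq_vecI) (auto simp: scalar_prod_def T_def lessThan_atLeast0)
  moreover have "(A ^\<^sub>m Suc k) *\<^sub>v vec n x = (A ^\<^sub>m k) *\<^sub>v (A *\<^sub>v vec n x)"
    using A by (simp add: assoc_mult_mat_vec[of _ n n _ n])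
  ultimately show ?case by (simp add: Suc funpow_swap1)
qed

lemma walk_matrix_eq_walk:
  assumes A: "A \<in> carrier_mat n n" "\<And>u v. u < n \<Longrightarrow> v < n \<Longrightarrow> A $$ (u, v) = a u v"
  shows "walk_matrix n A = walk"
proof (rule eq_matI)
  fix i j assume "i < dim_row walk" "j < dim_col walk"
  then have "i < n" "j < n" by (auto simp: walk_def)
  then show "walk_matrix n A $$ (i, j) = walk $$ (i, j)"
    by (simp add: walk_matrix_def walk_def mat_of_cols_index all_one_def pow_mat_mult_vec[OF A])
qed (auto simp: walk_matrix_def walk_def)

end

section \<open>Membership in \<open>U_set\<close>, entry by entry\<close>

lemma mat_adjoint_carrier: "U \<in> carrier_mat n n \<Longrightarrow> mat_adjoint U \<in> carrier_mat n n"
  unfolding mat_adjoint_def by auto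

lemma mat_adjoint_entry:
  assumes "U \<in> carrier_mat n n" "i < n" "j < n"
  shows "mat_adjoint U $$ (i, j) = cnj (U $$ (j, i))"
  unfolding mat_adjoint_def using assms by (simp add: mat_of_rows_index)

lemma mult_mat_entry:
  assumes "A \<in> carrier_mat n n" "B \<in> carrier_mat n n" "i < n" "j < n"
  shows "(A * B) $$ (i, j) = (\<Sum>k<n. A $$ (i, k) * B $$ (k, j))"
  using assms by (simp add: scalar_prod_def lessThan_atLeast0)

text \<open>Multiplying the similarity by \<open>U\<close> from the left gives AU = UB. The adjoint
  of \<open>U\<close> also fixes the all-one vector, and the resulting entries are the conjugated
  column sums of \<open>U\<close>.\<close>

lemma U_set_entries:
  assumes "U \<in> U_set n G"
  obtains H where "\<And>u j. u < n \<Longrightarrow> j < n \<Longrightarrow>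
      (\<Sum>v<n. graph_entry G u v * U $$ (v, j)) = (\<Sum>m<n. U $$ (u, m) * graph_entry H m j)"
    and "\<And>j m. j < n \<Longrightarrow> m < n \<Longrightarrow> (\<Sum>u<n. cnj (U $$ (u, j)) * U $$ (u, m)) = (if j = m then 1 else 0)"
    and "\<And>m. m < n \<Longrightarrow> (\<Sum>u<n. U $$ (u, m)) = 1"
proof -
  from assms obtain H where U: "U \<in> carrier_mat n n"
    and U1: "mat_adjoint U * U = 1\<^sub>m n" and U2: "U * mat_adjoint U = 1\<^sub>m n"
    and Ue: "U *\<^sub>v all_one n = all_one n"
    and UAU: "mat_adjoint U * hermitian_adjacency n G * U = hermitian_adjacency n H"
    by (auto simp: U_set_def gauss_rat_unitary_def)
  note Us = mat_adjoint_carrier[OF U]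
  define A B where "A = hermitian_adjacency n G" and "B = hermitian_adjacency n H"
  have AB: "A \<in> carrier_mat n n" "B \<in> carrier_mat n n" by (simp_all add: A_def B_def)
  have "U * B = U * (mat_adjoint U * (A * U))"
    using UAU AB U Us by (simp add: A_def B_def assoc_mult_mat[of _ n n _ n _ n])
  also have "\<dots> = (U * mat_adjoint U) * (A * U)"
    using AB U Us by (intro assoc_mult_mat[symmetric]) auto
  also have "\<dots> = A * U" unfolding U2 using AB U by simp
  finally have AU: "A * U = U * B" by simp
  have "(\<Sum>v<n. graph_entry G u v * U $$ (v, j)) = (\<Sum>m<n. U $$ (u, m) * graph_entry H m j)"
    if "u < n" "j < n" for u j
  proof -
    have "(A * U) $$ (u, j) = (U * B) $$ (u, j)" by (simp add: AU)
    then show ?thesis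
      using that U by (simp add: mult_mat_entry[of _ n] AB A_def B_def hermitian_adjacency_entry del: index_mult_mat)
  qed
  moreover have "(\<Sum>u<n. cnj (U $$ (u, j)) * U $$ (u, m)) = (if j = m then 1 else 0)"
    if "j < n" "m < n" for j m
  proof -
    have "(\<Sum>u<n. cnj (U $$ (u, j)) * U $$ (u, m)) = (mat_adjoint U * U) $$ (j, m)"
      unfolding mult_mat_entry[OF Us U that] using that U by (intro sum.cong) (auto simp: mat_adjoint_entry)
    then show ?thesis unfolding U1 using that by simp
  qed
  moreover have "(\<Sum>u<n. U $$ (u, m)) = 1" if m: "m < n" for m
  proof -
    have "mat_adjoint U *\<^sub>v all_one n = mat_adjoint U *\<^sub>v (U *\<^sub>v all_one n)" by (simp add: Ue)
    also have "\<dots> = (mat_adjoint U * U) *\<^sub>v all_one n"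
      using U Us by (intro assoc_mult_mat_vec[symmetric]) (auto simp: all_one_def)
    also have "\<dots> = all_one n" unfolding U1 by (simp add: all_one_def)
    finally have "(mat_adjoint U *\<^sub>v all_one n) $ m = 1" using m by (simp add: all_one_def)
    moreover have "(mat_adjoint U *\<^sub>v all_one n) $ m = (\<Sum>u<n. cnj (U $$ (u, m)))"
      using m U Us by (auto simp: scalar_prod_def all_one_def mat_adjoint_entry lessThan_atLeast0 intro!: sum.cong)
    ultimately have "cnj (\<Sum>u<n. U $$ (u, m)) = cnj 1" by simp
    then show ?thesis by (simp only: complex_cnj_cancel_iff)
  qed
  ultimately show thesis using that by blast
qed

text \<open>Otherwise \<open>l\<close> could be divided by \<open>1 + \<i>\<close> with the product
  still integral, and, moved into \<open>Gamma_set\<close> by a unit, the quotient would have half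
  the squared modulus.\<close>

lemma is_level_primitive:
  assumes l: "is_level U l" "gauss_even l"
  shows "\<exists>x\<in>elements_mat U. \<not> gauss_even (l * x)"
proof (rule ccontr)
  assume "\<not> ?thesis"
  then have ev: "gauss_even (l * x)" if "x \<in> elements_mat U" for x using that by auto
  have l0: "l \<noteq> 0" using l(1) by (auto simp: is_level_def Gamma_set_def)
  obtain c where c: "c \<in> gauss_ints" "l = (1 + \<i>) * c" using l(2) by (auto simp: gauss_dvd_def)
  have nz: "1 + \<i> \<noteq> 0" by (simp add: complex_eq_iff)
  have "c \<noteq> 0" using c l0 by auto
  then obtain w where w: "w \<in> {1, \<i>, -1, -\<i>}" "w * c \<in> Gamma_set"
    using Gamma_associate[OF c(1)] by blast
  have wg: "w \<in> gauss_ints" using w(1) by auto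
  have "w * c * x \<in> gauss_ints" if x: "x \<in> elements_mat U" for x
  proof -
    obtain d where d: "d \<in> gauss_ints" "(1 + \<i>) * c * x = (1 + \<i>) * d"
      using ev[OF x] c by (auto simp: gauss_dvd_def)
    then have "c * x = d" using nz by (simp add: mult.assoc)
    then have "w * c * x = w * d" by (simp only: mult.assoc)
    then show ?thesis using gauss_ints_closed(3)[OF wg d(1)] by (simp only:)
  qed
  then have "(cmod l)\<^sup>2 \<le> (cmod (w * c))\<^sup>2"
    using l(1) w(2) unfolding is_level_def elements_smult_iff by blast
  moreover have "cmod w = 1" using w(1) by auto
  moreover have "(cmod (1 + \<i>))\<^sup>2 = 2" by (simp add: cmod_power2)
  ultimately have "2 * (cmod c)\<^sup>2 \<le> (cmod c)\<^sup>2" by (simp add: c(2) norm_mult power_mult_distrib)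
  then show False using \<open>c \<noteq> 0\<close> by simp
qed

theorem theorem29:
  fixes n :: nat and G :: mixed_graph and A W U :: "complex mat" and l :: complex
  assumes "G \<in> self_converse_graphs n"
    and "A = hermitian_adjacency n G"
    and "W = walk_matrix n A"
    and "det W \<noteq> 0"
    and "U \<in> U_set n G"
    and "l = level U"
    and "\<not> 2 ^ (n div 2 + 1) gdvd det W"
  shows "\<not> 2 gdvd l"
proof
  assume l2: "2 gdvd l"
  have "G \<in> mixed_graphs n" using assms(1) by (simp add: self_converse_graphs_def)
  then interpret gauss_hermitian n "graph_entry G" by (rule gauss_hermitian_graph_entry)
  have W: "W = walk"
    unfolding assms(2,3) by (rule walk_matrix_eq_walk) (auto simp: hermitian_adjacency_entry)
  obtain f where "bij_betw f {..<n} {..<n}"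
    "\<And>u v. u < n \<Longrightarrow> v < n \<Longrightarrow> graph_entry G (f u) (f v) = cnj (graph_entry G u v)"
    using self_converse_bij[OF assms(1)] by blast
  then have odd: "odd (det half_gram)"
    using power_two_gdvd_det_walk assms(7) W by blast
  have U: "U \<in> carrier_mat n n" "elements_mat U \<subseteq> gauss_rats"
    using assms(5) by (auto simp: U_set_def gauss_rat_unitary_def)
  have level: "is_level U l" unfolding assms(6) using U(2) by (rule is_level_level)
  obtain x where x: "x \<in> elements_mat U" "\<not> gauss_even (l * x)"
    using is_level_primitive[OF level two_gdvd_imp_gauss_even[OF l2]] by blast
  obtain u j where uj: "u < n" "j < n" "x = U $$ (u, j)"
    using x(1) U(1) by (auto simp: elements_mat_def)
  have lU: "l * U $$ (u, j) \<in> gauss_ints" if "u < n" "j < n" for u j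
    using level that U(1) unfolding is_level_def elements_smult_iff by (auto simp: elements_mat_def)
  obtain H where "\<And>u j. u < n \<Longrightarrow> j < n \<Longrightarrow>
      (\<Sum>v<n. graph_entry G u v * U $$ (v, j)) = (\<Sum>m<n. U $$ (u, m) * graph_entry H m j)"
    and "\<And>j m. j < n \<Longrightarrow> m < n \<Longrightarrow> (\<Sum>u<n. cnj (U $$ (u, j)) * U $$ (u, m)) = (if j = m then 1 else 0)"
    and "\<And>m. m < n \<Longrightarrow> (\<Sum>u<n. U $$ (u, m)) = 1"
    using U_set_entries[OF assms(5)] by blast
  then have "gauss_even (l * U $$ (u, j))"
    using unitary_column_gauss_even[of "\<lambda>u j. U $$ (u, j)" "graph_entry H" l u j]
      assms(4) odd l2 lU uj graph_entry_gauss W by blast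
  then show False using x(2) uj(3) by simp
qed

end
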